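(* Let $\Gamma$ be a finite simplicial graph and let $\mathcal{G} = \{G_v \mid v \in V\Gamma\}$ be a family of non-trivial groups. The graph product $G = \Gamma\mathcal{G}$ has Grossman's property (A) if and only if for every central vertex $v$ of $\Gamma$ the vertex group $G_v$ has Grossman's property (A).
   Context: Graphs are simplicial: $V\Gamma$ is a set and $E\Gamma \subseteq \binom{V\Gamma}{2}$. The graph product $\Gamma\mathcal{G}$ of a family of groups $\mathcal{G} = \{G_v \mid v\in V\Gamma\}$ is the quotient of the free product $\ast_{v \in V\Gamma} G_v$ by the relations $g_u g_v = g_v g_u$ for all $g_u \in G_u$, $g_v \in G_v$ whenever $\{u,v\}\in E\Gamma$; the groups $G_v$ are the vertex groups. A vertex $v \in V\Gamma$ is central in $\Gamma$ if $\{u,v\}\in E\Gamma$ for all $u \in V\Gamma\setminus\{v\}$. A map $\phi\colon G \to G$ is pointwise inner if $\phi(g)$ is conjugate to $g$ in $G$ for every $g \in G$. A group $G$ has Grossman's property (A) if every pointwise inner automorphism of $G$ is inner. *)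

theory Defs
  imports "HOL.Hull" "HOL-Algebra.Elementary_Groups" "HOL-Library.Ramsey"
begin

definition simplicial_graph :: "'v set \<Rightarrow> 'v set set \<Rightarrow> bool" where
  "simplicial_graph V E \<longleftrightarrow> E \<subseteq> [V]\<^bsup>2\<^esup>"

definition central_vertex :: "'v set \<Rightarrow> 'v set set \<Rightarrow> 'v \<Rightarrow> bool" where
  "central_vertex V E v \<longleftrightarrow> v \<in> V \<and> (\<forall>u\<in>V - {v}. {u, v} \<in> E)"

text \<open>
  A word is a list of letters \<open>(v, g)\<close> with \<open>g\<close> in the vertex group of \<open>v\<close>; the label \<open>v\<close> keeps
  the vertex groups disjoint although they share one carrier type. The free product consists of
  the words modulo the monoid congruence that deletes trivial letters and multiplies adjacent
  letters with the same label.
\<close>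

definition fp_words :: "'v set \<Rightarrow> ('v \<Rightarrow> ('a, 'b) monoid_scheme) \<Rightarrow> ('v \<times> 'a) list set" where
  "fp_words V G = lists (SIGMA v:V. carrier (G v))"

inductive_set fp_rel ::
    "'v set \<Rightarrow> ('v \<Rightarrow> ('a, 'b) monoid_scheme) \<Rightarrow> (('v \<times> 'a) list \<times> ('v \<times> 'a) list) set"
  for V :: "'v set" and G :: "'v \<Rightarrow> ('a, 'b) monoid_scheme" where
  one: "(xs @ [(v, \<one>\<^bsub>G v\<^esub>)] @ ys, xs @ ys) \<in> fp_rel V G"
    if "v \<in> V" "xs \<in> fp_words V G" "ys \<in> fp_words V G"
| mult: "(xs @ [(v, g), (v, h)] @ ys, xs @ [(v, g \<otimes>\<^bsub>G v\<^esub> h)] @ ys) \<in> fp_rel V G"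
    if "v \<in> V" "g \<in> carrier (G v)" "h \<in> carrier (G v)" "xs \<in> fp_words V G" "ys \<in> fp_words V G"
| refl: "(xs, xs) \<in> fp_rel V G" if "xs \<in> fp_words V G"
| sym: "(xs, ys) \<in> fp_rel V G \<Longrightarrow> (ys, xs) \<in> fp_rel V G"
| trans: "(xs, ys) \<in> fp_rel V G \<Longrightarrow> (ys, zs) \<in> fp_rel V G \<Longrightarrow> (xs, zs) \<in> fp_rel V G"

definition free_product ::
    "'v set \<Rightarrow> ('v \<Rightarrow> ('a, 'b) monoid_scheme) \<Rightarrow> ('v \<times> 'a) list set monoid" where
  "free_product V G =
     \<lparr>carrier = fp_words V G // fp_rel V G,
      mult = (\<lambda>X Y. \<Union>x\<in>X. \<Union>y\<in>Y. fp_rel V G `` {x @ y}),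
      one = fp_rel V G `` {[]}\<rparr>"

definition fp_incl ::
    "'v set \<Rightarrow> ('v \<Rightarrow> ('a, 'b) monoid_scheme) \<Rightarrow> 'v \<Rightarrow> 'a \<Rightarrow> ('v \<times> 'a) list set" where
  "fp_incl V G v g = fp_rel V G `` {[(v, g)]}"

definition normal_closure :: "('a, 'b) monoid_scheme \<Rightarrow> 'a set \<Rightarrow> 'a set" where
  "normal_closure G S = (\<lambda>N. N \<lhd> G) hull S"

definition commutation_relators ::
    "'v set \<Rightarrow> 'v set set \<Rightarrow> ('v \<Rightarrow> ('a, 'b) monoid_scheme) \<Rightarrow> ('v \<times> 'a) list set set" where
  "commutation_relators V E G =
     (let F = free_product V G in
      {fp_incl V G u a \<otimes>\<^bsub>F\<^esub> fp_incl V G v b \<otimes>\<^bsub>F\<^esub> inv\<^bsub>F\<^esub> (fp_incl V G v b \<otimes>\<^bsub>F\<^esub> fp_incl V G u a)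
       | u v a b. {u, v} \<in> E \<and> a \<in> carrier (G u) \<and> b \<in> carrier (G v)})"

definition graph_product ::
    "'v set \<Rightarrow> 'v set set \<Rightarrow> ('v \<Rightarrow> ('a, 'b) monoid_scheme) \<Rightarrow> ('v \<times> 'a) list set set monoid" where
  "graph_product V E G =
     free_product V G Mod normal_closure (free_product V G) (commutation_relators V E G)"

definition conjugate_in :: "('a, 'b) monoid_scheme \<Rightarrow> 'a \<Rightarrow> 'a \<Rightarrow> bool" where
  "conjugate_in G x y \<longleftrightarrow> (\<exists>h\<in>carrier G. x = h \<otimes>\<^bsub>G\<^esub> y \<otimes>\<^bsub>G\<^esub> inv\<^bsub>G\<^esub> h)"

definition pointwise_inner :: "('a, 'b) monoid_scheme \<Rightarrow> ('a \<Rightarrow> 'a) \<Rightarrow> bool" where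
  "pointwise_inner G \<phi> \<longleftrightarrow> (\<forall>g\<in>carrier G. conjugate_in G (\<phi> g) g)"

definition inner_automorphism :: "('a, 'b) monoid_scheme \<Rightarrow> ('a \<Rightarrow> 'a) \<Rightarrow> bool" where
  "inner_automorphism G \<phi> \<longleftrightarrow>
     (\<exists>h\<in>carrier G. \<forall>g\<in>carrier G. \<phi> g = h \<otimes>\<^bsub>G\<^esub> g \<otimes>\<^bsub>G\<^esub> inv\<^bsub>G\<^esub> h)"

text \<open>
  Automorphisms are represented by elements of \<open>iso G G\<close>, whose values outside the carrier are
  arbitrary; all conditions are therefore restricted to the carrier.
\<close>

definition grossman_property_A :: "('a, 'b) monoid_scheme \<Rightarrow> bool" where
  "grossman_property_A G \<longleftrightarrow>
     (\<forall>\<phi>\<in>iso G G. pointwise_inner G \<phi> \<longrightarrow> inner_automorphism G \<phi>)"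

lemma fp_words_simps [simp]:
  "[] \<in> fp_words V G"
  "x # xs \<in> fp_words V G \<longleftrightarrow> fst x \<in> V \<and> snd x \<in> carrier (G (fst x)) \<and> xs \<in> fp_words V G"
  "xs @ ys \<in> fp_words V G \<longleftrightarrow> xs \<in> fp_words V G \<and> ys \<in> fp_words V G"
  by (cases x; auto simp: fp_words_def)+

lemma group_free_product:
  assumes G: "\<And>v. v \<in> V \<Longrightarrow> group (G v)"
  shows "group (free_product V G)"
proof -
  let ?W = "fp_words V G" and ?R = "fp_rel V G" and ?F = "free_product V G"
  have words: "xs \<in> ?W \<and> ys \<in> ?W" if "(xs, ys) \<in> ?R" for xs ys
    using that by induction (auto simp: group.is_monoid G monoid.m_closed)
  have eq: "equiv ?W ?R"
  proof (rule equivI)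
    show "?R \<subseteq> ?W \<times> ?W" using words by auto
    show "refl_on ?W ?R" by (rule refl_onI) (rule fp_rel.refl)
    show "sym_on UNIV ?R" by (rule symI) (rule fp_rel.sym)
    show "trans_on UNIV ?R" by (rule transI) (rule fp_rel.trans)
  qed
  have ctxt: "(us @ xs @ ws, us @ ys @ ws) \<in> ?R"
    if "(xs, ys) \<in> ?R" "us \<in> ?W" "ws \<in> ?W" for us xs ys ws
    using that
  proof induction
    case (one v xs ys)
    then show ?case using fp_rel.one[of v V "us @ xs" G "ys @ ws"] by simp
  next
    case (mult v g h xs ys)
    then show ?case using fp_rel.mult[of v V g G h "us @ xs" "ys @ ws"] by simp
  next
    case (refl xs)
    then show ?case by (auto intro: fp_rel.refl)
  qed (blast intro: fp_rel.sym fp_rel.trans)+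
  have app: "(xs @ ys, xs' @ ys') \<in> ?R" if "(xs, xs') \<in> ?R" "(ys, ys') \<in> ?R" for xs ys xs' ys'
  proof -
    have "(xs @ ys, xs' @ ys) \<in> ?R" using ctxt[OF that(1), of "[]" ys] words[OF that(2)] by simp
    moreover have "(xs' @ ys, xs' @ ys') \<in> ?R"
      using ctxt[OF that(2), of xs' "[]"] words[OF that(1)] by simp
    ultimately show ?thesis by (rule fp_rel.trans)
  qed
  have cls: "?R `` {xs} = ?R `` {ys} \<longleftrightarrow> (xs, ys) \<in> ?R" if "xs \<in> ?W" "ys \<in> ?W" for xs ys
    using eq_equiv_class_iff[OF eq that] .
  have prod: "?R `` {xs} \<otimes>\<^bsub>?F\<^esub> ?R `` {ys} = ?R `` {xs @ ys}" if "xs \<in> ?W" "ys \<in> ?W" for xs ys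
  proof -
    have "?R `` {x @ y} = ?R `` {xs @ ys}" if "x \<in> ?R `` {xs}" "y \<in> ?R `` {ys}" for x y
      using app[of xs x ys y] equiv_class_eq[OF eq] that by blast
    moreover have "xs \<in> ?R `` {xs}" "ys \<in> ?R `` {ys}"
      using that by (auto intro: fp_rel.refl)
    ultimately have "(\<Union>x\<in>?R `` {xs}. \<Union>y\<in>?R `` {ys}. ?R `` {x @ y}) = ?R `` {xs @ ys}"
      by blast
    then show ?thesis by (simp add: free_product_def)
  qed
  have carrier: "carrier ?F = (\<lambda>xs. ?R `` {xs}) ` ?W"
    by (auto simp: free_product_def quotient_def)
  have one: "\<one>\<^bsub>?F\<^esub> = ?R `` {[]}"
    by (simp add: free_product_def)
  have inv: "\<exists>ys\<in>?W. (ys @ xs, []) \<in> ?R" if "xs \<in> ?W" for xs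
    using that
  proof (induction xs)
    case Nil
    have "([] @ [], []) \<in> ?R" by (simp add: fp_rel.refl)
    then show ?case using fp_words_simps(1) by blast
  next
    case (Cons x xs)
    obtain v g where x: "x = (v, g)" by force
    have v: "v \<in> V" and g: "g \<in> carrier (G v)" and xs: "xs \<in> ?W"
      using Cons.prems x by auto
    interpret Gv: group "G v" using G[OF v] .
    obtain ys where ys: "ys \<in> ?W" "(ys @ xs, []) \<in> ?R" using Cons.IH xs by blast
    have "((ys @ [(v, inv\<^bsub>G v\<^esub> g), (v, g)] @ xs), ys @ [(v, inv\<^bsub>G v\<^esub> g \<otimes>\<^bsub>G v\<^esub> g)] @ xs) \<in> ?R"
      using v g xs ys by (intro fp_rel.mult) auto
    moreover have "(ys @ [(v, inv\<^bsub>G v\<^esub> g \<otimes>\<^bsub>G v\<^esub> g)] @ xs, ys @ xs) \<in> ?R"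
      using v g xs ys fp_rel.one[of v V ys G xs] by simp
    ultimately have "((ys @ [(v, inv\<^bsub>G v\<^esub> g)]) @ x # xs, []) \<in> ?R"
      using ys(2) x by (auto intro: fp_rel.trans)
    moreover have "ys @ [(v, inv\<^bsub>G v\<^esub> g)] \<in> ?W" using v g ys by simp
    ultimately show ?case by blast
  qed
  show ?thesis
  proof (rule groupI)
    fix X Y assume "X \<in> carrier ?F" "Y \<in> carrier ?F"
    then show "X \<otimes>\<^bsub>?F\<^esub> Y \<in> carrier ?F" by (auto simp: carrier prod)
  next
    show "\<one>\<^bsub>?F\<^esub> \<in> carrier ?F" by (simp add: carrier one)
  next
    fix X Y Z assume "X \<in> carrier ?F" "Y \<in> carrier ?F" "Z \<in> carrier ?F"
    then show "X \<otimes>\<^bsub>?F\<^esub> Y \<otimes>\<^bsub>?F\<^esub> Z = X \<otimes>\<^bsub>?F\<^esub> (Y \<otimes>\<^bsub>?F\<^esub> Z)"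
      by (auto simp: carrier prod)
  next
    fix X assume "X \<in> carrier ?F"
    then show "\<one>\<^bsub>?F\<^esub> \<otimes>\<^bsub>?F\<^esub> X = X" by (auto simp: carrier prod one)
  next
    fix X assume "X \<in> carrier ?F"
    then obtain xs where xs: "xs \<in> ?W" "X = ?R `` {xs}" by (auto simp: carrier)
    then obtain ys where "ys \<in> ?W" "(ys @ xs, []) \<in> ?R" using inv by blast
    then show "\<exists>Y\<in>carrier ?F. Y \<otimes>\<^bsub>?F\<^esub> X = \<one>\<^bsub>?F\<^esub>"
      using xs by (auto simp: carrier prod one cls intro!: bexI[of _ ys])
  qed
qed

lemma commutation_relators_subset:
  assumes "simplicial_graph V E" and G: "\<And>v. v \<in> V \<Longrightarrow> group (G v)"
  shows "commutation_relators V E G \<subseteq> carrier (free_product V G)"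
proof -
  interpret F: group "free_product V G" using group_free_product G .
  have "fp_incl V G v a \<in> carrier (free_product V G)" if "v \<in> V" "a \<in> carrier (G v)" for v a
    using that by (auto simp: fp_incl_def free_product_def intro!: quotientI)
  moreover have "u \<in> V \<and> v \<in> V" if "{u, v} \<in> E" for u v
    using assms(1) that by (auto simp: simplicial_graph_def nsets_def)
  ultimately show ?thesis
    by (auto simp: commutation_relators_def Let_def)
qed

lemma normal_normal_closure:
  assumes "group G" "S \<subseteq> carrier G"
  shows "normal_closure G S \<lhd> G"
proof -
  interpret group G by fact
  let ?A = "{N. N \<lhd> G \<and> S \<subseteq> N}"
  have A: "carrier G \<in> ?A"
    using assms(2) normal_inv_iff subgroup_self by auto
  have "subgroup (\<Inter>?A) G"
    using A by (intro subgroups_Inter) (auto simp: normal_inv_iff)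
  then show ?thesis
    by (auto simp: normal_closure_def hull_def normal_inv_iff)
qed

lemma group_graph_product:
  assumes "simplicial_graph V E" "\<And>v. v \<in> V \<Longrightarrow> group (G v)"
  shows "group (graph_product V E G)"
  unfolding graph_product_def
  by (intro normal.factorgroup_is_group normal_normal_closure group_free_product
      commutation_relators_subset assms)

end

theory Submission
  imports Defs
begin

text \<open>
  Let \<open>\<phi>\<close> be a pointwise inner automorphism of the graph product. For non-trivial \<open>a\<close> and \<open>b\<close> in
  the vertex groups of \<open>u\<close> and \<open>v\<close>, write \<open>\<phi> a\<close> and \<open>\<phi> b\<close> as the conjugates of \<open>a\<close> by \<open>h\<close>
  and of \<open>b\<close> by \<open>g\<close>. As \<open>\<phi> (a b)\<close> is conjugate to \<open>a b\<close>, comparing the lengths of large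
  powers shows that the left cosets of \<open>h\<close> and \<open>g\<close> modulo the parabolic subgroups of the stars of
  \<open>u\<close> and \<open>v\<close> intersect. By the Helly property of parabolic cosets, \<open>\<phi>\<close> may be composed with an
  inner automorphism so that it maps every vertex group to itself, by a pointwise inner
  automorphism. If \<open>v\<close> is not central, take \<open>u\<close> not adjacent to \<open>v\<close>: since \<open>b a\<close> is conjugate to its image,
  counting the occurrences of the letter \<open>b\<close> in large powers gives \<open>\<phi> b = b\<close>. On the vertex
  groups of the central vertices \<open>\<phi>\<close> is inner by assumption, and the conjugating elements commute
  with all other vertex groups. Conversely, a pointwise inner automorphism of a central vertex group
  extends to the graph product, of which that vertex group is a direct factor.
\<close>

subsection \<open>Pointwise inner endomorphisms\<close>

lemma conjugate_in_one_iff: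
  "group H \<Longrightarrow> y \<in> carrier H \<Longrightarrow> conjugate_in H x y \<Longrightarrow> x = \<one>\<^bsub>H\<^esub> \<longleftrightarrow> y = \<one>\<^bsub>H\<^esub>"
proof -
  assume "group H" "y \<in> carrier H" "conjugate_in H x y"
  then interpret group H by simp
  obtain h where h: "h \<in> carrier H" "x = h \<otimes>\<^bsub>H\<^esub> y \<otimes>\<^bsub>H\<^esub> inv\<^bsub>H\<^esub> h"
    using \<open>conjugate_in H x y\<close> by (auto simp: conjugate_in_def)
  then have "y = inv\<^bsub>H\<^esub> h \<otimes>\<^bsub>H\<^esub> x \<otimes>\<^bsub>H\<^esub> h"
    using \<open>y \<in> carrier H\<close> by (simp add: m_assoc inv_solve_left)
  then show ?thesis using h by auto
qed

lemma pointwise_innerE: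
  assumes "pointwise_inner H \<phi>" "g \<in> carrier H"
  obtains h where "h \<in> carrier H" "\<phi> g = h \<otimes>\<^bsub>H\<^esub> g \<otimes>\<^bsub>H\<^esub> inv\<^bsub>H\<^esub> h"
  using assms by (auto simp: pointwise_inner_def conjugate_in_def)

text \<open>Only the identity is conjugate to the identity, so the kernel is trivial. In both
  directions of the theorem this leaves surjectivity as the only point to check for
  bijectivity.\<close>

lemma pointwise_inner_inj_on:
  assumes "group H" "\<phi> \<in> hom H H" "pointwise_inner H \<phi>"
  shows "inj_on \<phi> (carrier H)"
proof -
  have "g = \<one>\<^bsub>H\<^esub>" if "g \<in> carrier H" "\<phi> g = \<one>\<^bsub>H\<^esub>" for g
  proof -
    have "conjugate_in H (\<phi> g) g" using assms(3) that(1) unfolding pointwise_inner_def by blast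
    then show ?thesis using conjugate_in_one_iff[OF assms(1) that(1)] that(2) by blast
  qed
  then show ?thesis using inj_on_one_iff'[OF assms(2,1,1)] by blast
qed

subsection \<open>Words representing elements of a graph product\<close>

locale graph_of_groups =
  fixes V :: "'v set" and E :: "'v set set" and G :: "'v \<Rightarrow> ('a, 'b) monoid_scheme"
  assumes simplicial: "simplicial_graph V E"
    and vertex_group: "\<And>v. v \<in> V \<Longrightarrow> group (G v)"
begin

definition adj :: "'v \<Rightarrow> 'v \<Rightarrow> bool" where
  "adj u v \<longleftrightarrow> {u, v} \<in> E"

lemma adj_sym: "adj u v \<Longrightarrow> adj v u"
  by (simp add: adj_def insert_commute)

lemma adj_vertices: "adj u v \<Longrightarrow> u \<in> V \<and> v \<in> V \<and> u \<noteq> v"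
proof -
  assume "adj u v"
  then have "{u, v} \<in> [V]\<^bsup>2\<^esup>" using simplicial unfolding adj_def simplicial_graph_def by blast
  then show ?thesis by (cases "u = v") (auto simp: nsets_def)
qed

abbreviation W :: "('v \<times> 'a) list set" where
  "W \<equiv> fp_words V G"

lemma vertex_one [simp]: "v \<in> V \<Longrightarrow> \<one>\<^bsub>G v\<^esub> \<in> carrier (G v)"
  by (rule monoid.one_closed[OF group.is_monoid[OF vertex_group]])

lemma vertex_mult [simp]:
  "v \<in> V \<Longrightarrow> g \<in> carrier (G v) \<Longrightarrow> h \<in> carrier (G v) \<Longrightarrow> g \<otimes>\<^bsub>G v\<^esub> h \<in> carrier (G v)"
  by (rule monoid.m_closed[OF group.is_monoid[OF vertex_group]])

lemma vertex_inv [simp]: "v \<in> V \<Longrightarrow> g \<in> carrier (G v) \<Longrightarrow> inv\<^bsub>G v\<^esub> g \<in> carrier (G v)"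
  by (rule group.inv_closed[OF vertex_group])

lemma words_filter [simp]: "w \<in> W \<Longrightarrow> filter P w \<in> W"
  by (induction w) auto

text \<open>The graph product is a quotient of a quotient, which hides its words. This congruence
  adds the commutations to the rules of \<open>fp_rel\<close>, so that claims about the graph
  product become rule inductions on words; \<open>pi_eq_iff\<close> identifies it with equality in
  the graph product.\<close>

inductive gp_eq :: "('v \<times> 'a) list \<Rightarrow> ('v \<times> 'a) list \<Rightarrow> bool" where
  one: "gp_eq (xs @ [(v, \<one>\<^bsub>G v\<^esub>)] @ ys) (xs @ ys)"
    if "v \<in> V" "xs \<in> W" "ys \<in> W"
| mult: "gp_eq (xs @ [(v, g), (v, h)] @ ys) (xs @ [(v, g \<otimes>\<^bsub>G v\<^esub> h)] @ ys)"
    if "v \<in> V" "g \<in> carrier (G v)" "h \<in> carrier (G v)" "xs \<in> W" "ys \<in> W"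
| comm: "gp_eq (xs @ [(u, g), (v, h)] @ ys) (xs @ [(v, h), (u, g)] @ ys)"
    if "adj u v" "g \<in> carrier (G u)" "h \<in> carrier (G v)" "xs \<in> W" "ys \<in> W"
| refl: "gp_eq xs xs" if "xs \<in> W"
| sym: "gp_eq xs ys \<Longrightarrow> gp_eq ys xs"
| trans: "gp_eq xs ys \<Longrightarrow> gp_eq ys zs \<Longrightarrow> gp_eq xs zs"

lemma gp_eq_words: "gp_eq w w' \<Longrightarrow> w \<in> W \<and> w' \<in> W"
  by (induction rule: gp_eq.induct) (auto dest: adj_vertices)

lemma gp_eq_context:
  assumes "gp_eq w w'" "us \<in> W" "zs \<in> W"
  shows "gp_eq (us @ w @ zs) (us @ w' @ zs)"
  using assms
proof induction
  case (one v xs ys)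
  then show ?case using gp_eq.one[of v "us @ xs" "ys @ zs"] by simp
next
  case (mult v g h xs ys)
  then show ?case using gp_eq.mult[of v g h "us @ xs" "ys @ zs"] by simp
next
  case (comm u v g h xs ys)
  then show ?case using gp_eq.comm[of u v g h "us @ xs" "ys @ zs"] by simp
next
  case (refl xs)
  then show ?case by (auto intro: gp_eq.refl)
qed (blast intro: gp_eq.sym gp_eq.trans)+

lemma gp_eq_append:
  assumes "gp_eq x x'" "gp_eq y y'"
  shows "gp_eq (x @ y) (x' @ y')"
proof -
  have "gp_eq (x @ y) (x' @ y)"
    using gp_eq_context[OF assms(1), of "[]" y] gp_eq_words[OF assms(2)] by simp
  moreover have "gp_eq (x' @ y) (x' @ y')"
    using gp_eq_context[OF assms(2), of x' "[]"] gp_eq_words[OF assms(1)] by simp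
  ultimately show ?thesis by (rule gp_eq.trans)
qed

lemma fp_rel_imp_gp_eq: "(w, w') \<in> fp_rel V G \<Longrightarrow> gp_eq w w'"
proof (induction rule: fp_rel.induct)
  case trans
  then show ?case by (blast intro: gp_eq.trans)
qed (simp_all only: gp_eq.one gp_eq.mult gp_eq.refl gp_eq.sym)

definition inv_word :: "('v \<times> 'a) list \<Rightarrow> ('v \<times> 'a) list" where
  "inv_word w = rev (map (\<lambda>x. (fst x, inv\<^bsub>G (fst x)\<^esub> (snd x))) w)"

lemma inv_word_simps [simp]:
  "inv_word [] = []"
  "inv_word (x # w) = inv_word w @ [(fst x, inv\<^bsub>G (fst x)\<^esub> (snd x))]"
  "inv_word (w @ w') = inv_word w' @ inv_word w"
  "length (inv_word w) = length w"
  by (auto simp: inv_word_def)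

lemma inv_word_words [simp]: "w \<in> W \<Longrightarrow> inv_word w \<in> W"
  by (induction w) auto

lemma inv_word_inv_word: "w \<in> W \<Longrightarrow> inv_word (inv_word w) = w"
  by (induction w) (auto simp: group.inv_inv vertex_group)

text \<open>Proved for the finer relation \<open>fp_rel\<close>, because \<open>inv_cls\<close>
  computes inverses in the free product itself.\<close>

lemma fp_rel_inv_word: "w \<in> W \<Longrightarrow> (inv_word w @ w, []) \<in> fp_rel V G"
proof (induction w)
  case Nil
  then show ?case by (simp add: fp_rel.refl)
next
  case (Cons x w)
  obtain v g where x: "x = (v, g)" by force
  have v: "v \<in> V" "g \<in> carrier (G v)" "w \<in> W" using Cons.prems x by auto
  have "(inv_word w @ [(v, inv\<^bsub>G v\<^esub> g), (v, g)] @ w, inv_word w @ [(v, inv\<^bsub>G v\<^esub> g \<otimes>\<^bsub>G v\<^esub> g)] @ w)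
      \<in> fp_rel V G"
    using v by (intro fp_rel.mult) auto
  also have "inv\<^bsub>G v\<^esub> g \<otimes>\<^bsub>G v\<^esub> g = \<one>\<^bsub>G v\<^esub>"
    using v by (simp add: group.l_inv vertex_group)
  finally have "(inv_word w @ [(v, inv\<^bsub>G v\<^esub> g), (v, g)] @ w, inv_word w @ w) \<in> fp_rel V G"
    by (rule fp_rel.trans) (use v in \<open>intro fp_rel.one; simp\<close>)
  from fp_rel.trans[OF this Cons.IH[OF v(3)]] show ?case using x by simp
qed

lemma gp_eq_inv_word: "w \<in> W \<Longrightarrow> gp_eq (inv_word w @ w) []"
  by (rule fp_rel_imp_gp_eq) (rule fp_rel_inv_word)

lemma gp_eq_inv_word': "w \<in> W \<Longrightarrow> gp_eq (w @ inv_word w) []"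
  using gp_eq_inv_word[OF inv_word_words] inv_word_inv_word by metis

section \<open>The free product and the normal closure of the commutation relators\<close>

abbreviation F :: "('v \<times> 'a) list set monoid" where
  "F \<equiv> free_product V G"

definition cls :: "('v \<times> 'a) list \<Rightarrow> ('v \<times> 'a) list set" where
  "cls w = fp_rel V G `` {w}"

lemma group_F: "group F"
  by (rule group_free_product) (rule vertex_group)

lemma equiv_fp_rel: "equiv W (fp_rel V G)"
proof (rule equivI)
  show "fp_rel V G \<subseteq> W \<times> W" using fp_rel_imp_gp_eq gp_eq_words by auto
  show "refl_on W (fp_rel V G)" by (rule refl_onI) (rule fp_rel.refl)
  show "sym_on UNIV (fp_rel V G)" by (rule symI) (rule fp_rel.sym)
  show "trans_on UNIV (fp_rel V G)" by (rule transI) (rule fp_rel.trans)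
qed

lemma fp_rel_append:
  assumes "(x, x') \<in> fp_rel V G" "(y, y') \<in> fp_rel V G"
  shows "(x @ y, x' @ y') \<in> fp_rel V G"
proof -
  have ctxt: "(us @ w @ zs, us @ w' @ zs) \<in> fp_rel V G"
    if "(w, w') \<in> fp_rel V G" "us \<in> W" "zs \<in> W" for w w' us zs
    using that
  proof induction
    case (one v xs ys)
    then show ?case using fp_rel.one[of v V "us @ xs" G "ys @ zs"] by simp
  next
    case (mult v g h xs ys)
    then show ?case using fp_rel.mult[of v V g G h "us @ xs" "ys @ zs"] by simp
  next
    case (refl xs)
    then show ?case by (auto intro: fp_rel.refl)
  qed (blast intro: fp_rel.sym fp_rel.trans)+
  have "x' \<in> W" "y \<in> W" using assms by (auto dest!: fp_rel_imp_gp_eq gp_eq_words)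
  then show ?thesis
    using ctxt[OF assms(1), of "[]" y] ctxt[OF assms(2), of x' "[]"] by (auto intro: fp_rel.trans)
qed

lemma cls_eq_iff: "w \<in> W \<Longrightarrow> w' \<in> W \<Longrightarrow> cls w = cls w' \<longleftrightarrow> (w, w') \<in> fp_rel V G"
  unfolding cls_def by (rule eq_equiv_class_iff[OF equiv_fp_rel])

lemma carrier_F: "carrier F = cls ` W"
  by (auto simp: free_product_def quotient_def cls_def)

lemma one_F: "\<one>\<^bsub>F\<^esub> = cls []"
  by (simp add: free_product_def cls_def)

lemma cls_append:
  assumes "x \<in> W" "y \<in> W"
  shows "cls x \<otimes>\<^bsub>F\<^esub> cls y = cls (x @ y)"
proof -
  have "cls (a @ b) = cls (x @ y)" if "a \<in> cls x" "b \<in> cls y" for a b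
    using fp_rel_append[of x a y b] equiv_class_eq[OF equiv_fp_rel] that
    unfolding cls_def by blast
  moreover have "x \<in> cls x" "y \<in> cls y"
    using assms by (auto simp: cls_def intro: fp_rel.refl)
  ultimately have "(\<Union>a\<in>cls x. \<Union>b\<in>cls y. cls (a @ b)) = cls (x @ y)"
    by blast
  then show ?thesis by (simp add: free_product_def cls_def)
qed

lemma cls_closed [simp]: "w \<in> W \<Longrightarrow> cls w \<in> carrier F"
  by (simp add: carrier_F)

lemma inv_cls: "w \<in> W \<Longrightarrow> inv\<^bsub>F\<^esub> cls w = cls (inv_word w)"
  by (intro group.inv_equality[OF group_F])
     (auto simp: cls_append one_F cls_eq_iff fp_rel_inv_word)

definition N :: "('v \<times> 'a) list set set" where
  "N = normal_closure F (commutation_relators V E G)"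

lemma normal_N: "N \<lhd> F"
  unfolding N_def
  by (intro normal_normal_closure group_F commutation_relators_subset simplicial vertex_group)

lemma relators_subset_N: "commutation_relators V E G \<subseteq> N"
  by (simp add: N_def normal_closure_def hull_subset)

lemma relator_in_N:
  assumes "adj u v" "a \<in> carrier (G u)" "b \<in> carrier (G v)"
  shows "cls ([(u, a), (v, b)] @ inv_word [(v, b), (u, a)]) \<in> N"
proof -
  have w: "[(u, a)] \<in> W" "[(v, b)] \<in> W" using assms adj_vertices by auto
  have incl: "fp_incl V G u a = cls [(u, a)]" "fp_incl V G v b = cls [(v, b)]"
    by (simp_all add: fp_incl_def cls_def)
  have "fp_incl V G u a \<otimes>\<^bsub>F\<^esub> fp_incl V G v b
      \<otimes>\<^bsub>F\<^esub> inv\<^bsub>F\<^esub> (fp_incl V G v b \<otimes>\<^bsub>F\<^esub> fp_incl V G u a) \<in> commutation_relators V E G"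
    using assms unfolding commutation_relators_def Let_def adj_def by blast
  then have "cls [(u, a)] \<otimes>\<^bsub>F\<^esub> cls [(v, b)] \<otimes>\<^bsub>F\<^esub> inv\<^bsub>F\<^esub> (cls [(v, b)] \<otimes>\<^bsub>F\<^esub> cls [(u, a)]) \<in> N"
    using relators_subset_N unfolding incl by blast
  then show ?thesis using w by (simp add: cls_append inv_cls)
qed

text \<open>The classes of the words that \<open>gp_eq\<close> makes empty form a normal subgroup
  containing the relators, and \<open>N\<close> is the least such subgroup. Hence the quotient
  identifies no more words than \<open>gp_eq\<close> does.\<close>

lemma N_subset: "N \<subseteq> cls ` {w. gp_eq w []}"
proof -
  let ?K = "cls ` {w. gp_eq w []}"
  have "?K \<lhd> F"
  proof (rule group.normal_invI[OF group_F])
    show "subgroup ?K F"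
    proof (rule group.subgroupI[OF group_F])
      show "?K \<subseteq> carrier F" using gp_eq_words by auto
      show "?K \<noteq> {}" using gp_eq.refl by force
    next
      fix X assume "X \<in> ?K"
      then obtain w where w: "X = cls w" "gp_eq w []" by auto
      then have W: "w \<in> W" using gp_eq_words by blast
      have "gp_eq (inv_word w) (inv_word w @ w)"
        using w W gp_eq_append[of "inv_word w" "inv_word w" "[]" w]
        by (simp add: gp_eq.refl[OF inv_word_words[OF W]] gp_eq.sym[OF w(2)])
      then have "gp_eq (inv_word w) []"
        using gp_eq_inv_word[OF W] gp_eq.trans by blast
      then show "inv\<^bsub>F\<^esub> X \<in> ?K" using w W by (simp add: inv_cls)
    next
      fix X Y assume "X \<in> ?K" "Y \<in> ?K"
      then obtain w z where "X = cls w" "gp_eq w []" "Y = cls z" "gp_eq z []" by auto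
      moreover from this have "gp_eq (w @ z) []" using gp_eq_append[of w "[]" z "[]"] by simp
      ultimately show "X \<otimes>\<^bsub>F\<^esub> Y \<in> ?K" using gp_eq_words by (auto simp: cls_append)
    qed
  next
    fix X Y assume "X \<in> carrier F" "Y \<in> ?K"
    then obtain w z where w: "X = cls w" "w \<in> W" "Y = cls z" "gp_eq z []"
      by (auto simp: carrier_F)
    then have z: "z \<in> W" using gp_eq_words by blast
    have "gp_eq (w @ z @ inv_word w) (w @ inv_word w)"
      using gp_eq_context[OF w(4), of w "inv_word w"] w by simp
    then have "gp_eq (w @ z @ inv_word w) []"
      using gp_eq_inv_word'[OF w(2)] gp_eq.trans by blast
    then show "X \<otimes>\<^bsub>F\<^esub> Y \<otimes>\<^bsub>F\<^esub> inv\<^bsub>F\<^esub> X \<in> ?K"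
      using w z by (auto simp: cls_append inv_cls)
  qed
  moreover have "commutation_relators V E G \<subseteq> ?K"
  proof
    fix X assume "X \<in> commutation_relators V E G"
    then obtain u v a b where X: "adj u v" "a \<in> carrier (G u)" "b \<in> carrier (G v)"
      "X = fp_incl V G u a \<otimes>\<^bsub>F\<^esub> fp_incl V G v b
        \<otimes>\<^bsub>F\<^esub> inv\<^bsub>F\<^esub> (fp_incl V G v b \<otimes>\<^bsub>F\<^esub> fp_incl V G u a)"
      unfolding commutation_relators_def Let_def adj_def by blast
    have w: "[(u, a)] \<in> W" "[(v, b)] \<in> W" using X adj_vertices by auto
    have "fp_incl V G u a = cls [(u, a)]" "fp_incl V G v b = cls [(v, b)]"
      by (simp_all add: fp_incl_def cls_def)
    then have eq: "X = cls ([(u, a), (v, b)] @ inv_word [(v, b), (u, a)])"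
      using w X(4) by (simp add: cls_append inv_cls)
    have "gp_eq ([(u, a), (v, b)] @ inv_word [(v, b), (u, a)])
        ([(v, b), (u, a)] @ inv_word [(v, b), (u, a)])"
      using gp_eq.comm[OF X(1-3), of "[]" "inv_word [(v, b), (u, a)]"] w by simp
    moreover have "gp_eq ([(v, b), (u, a)] @ inv_word [(v, b), (u, a)]) []"
      using w by (intro gp_eq_inv_word') auto
    ultimately show "X \<in> ?K" using eq gp_eq.trans by blast
  qed
  ultimately show ?thesis
    unfolding N_def normal_closure_def by (intro hull_minimal)
qed

section \<open>The map from words to the graph product\<close>

abbreviation Q :: "('v \<times> 'a) list set set monoid" where
  "Q \<equiv> graph_product V E G"

definition pi :: "('v \<times> 'a) list \<Rightarrow> ('v \<times> 'a) list set set" where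
  "pi w = N #>\<^bsub>F\<^esub> cls w"

lemma Q_eq: "Q = F Mod N"
  by (simp add: graph_product_def N_def)

sublocale Q: group Q
  by (intro group_graph_product simplicial vertex_group)

lemma pi_closed [simp]: "w \<in> W \<Longrightarrow> pi w \<in> carrier Q"
  by (auto simp: Q_eq FactGroup_def RCOSETS_def pi_def carrier_F)

lemma pi_surj: "q \<in> carrier Q \<Longrightarrow> \<exists>w\<in>W. q = pi w"
  by (auto simp: Q_eq FactGroup_def RCOSETS_def pi_def carrier_F)

lemma pi_append: "x \<in> W \<Longrightarrow> y \<in> W \<Longrightarrow> pi (x @ y) = pi x \<otimes>\<^bsub>Q\<^esub> pi y"
  by (simp add: Q_eq FactGroup_def pi_def normal.rcos_sum[OF normal_N] cls_append)

lemma pi_Nil: "pi [] = \<one>\<^bsub>Q\<^esub>"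
proof -
  have "pi [] \<otimes>\<^bsub>Q\<^esub> pi [] = pi []" using pi_append[of "[]" "[]"] by simp
  then show ?thesis using Q.l_cancel_one' pi_closed[of "[]"] by auto
qed

lemma pi_eq_pi_iff_N:
  assumes "w \<in> W" "w' \<in> W"
  shows "pi w = pi w' \<longleftrightarrow> cls (w @ inv_word w') \<in> N"
proof -
  interpret F: group F by (rule group_F)
  have sub: "subgroup N F" using normal_N by (rule normal_imp_subgroup)
  have "pi w = pi w' \<longleftrightarrow> cls w \<in> N #>\<^bsub>F\<^esub> cls w'"
  proof
    assume "pi w = pi w'"
    moreover have "cls w \<in> N #>\<^bsub>F\<^esub> cls w"
      using F.rcos_self[OF _ sub] assms by simp
    ultimately show "cls w \<in> N #>\<^bsub>F\<^esub> cls w'" by (simp add: pi_def)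
  next
    assume "cls w \<in> N #>\<^bsub>F\<^esub> cls w'"
    then show "pi w = pi w'"
      using F.repr_independence[OF _ _ sub] assms by (auto simp: pi_def)
  qed
  also have "\<dots> \<longleftrightarrow> cls w \<otimes>\<^bsub>F\<^esub> inv\<^bsub>F\<^esub> cls w' \<in> N"
    using subgroup.rcos_module[OF sub group_F, of "cls w'" "cls w"] assms by simp
  finally show ?thesis using assms by (simp add: inv_cls cls_append)
qed

text \<open>The first two rules hold already in the free product; a commutation holds modulo
  \<open>N\<close> because the corresponding commutator is a relator.\<close>

lemma gp_eq_imp_pi: "gp_eq w w' \<Longrightarrow> pi w = pi w'"
proof (induction rule: gp_eq.induct)
  case (one v xs ys)
  then have "cls (xs @ [(v, \<one>\<^bsub>G v\<^esub>)] @ ys) = cls (xs @ ys)"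
    by (subst cls_eq_iff) (auto simp: fp_rel.one[simplified])
  then show ?case by (simp add: pi_def)
next
  case (mult v g h xs ys)
  then have "cls (xs @ [(v, g), (v, h)] @ ys) = cls (xs @ [(v, g \<otimes>\<^bsub>G v\<^esub> h)] @ ys)"
    by (subst cls_eq_iff) (auto simp: fp_rel.mult[simplified])
  then show ?case by (simp add: pi_def)
next
  case (comm u v g h xs ys)
  then have w: "[(u, g), (v, h)] \<in> W" "[(v, h), (u, g)] \<in> W" using adj_vertices by auto
  have "pi [(u, g), (v, h)] = pi [(v, h), (u, g)]"
    using pi_eq_pi_iff_N[OF w] relator_in_N comm by simp
  then show ?case using comm w by (simp only: pi_append fp_words_simps(3))
qed auto

lemma pi_eq_iff:
  assumes "w \<in> W" "w' \<in> W"
  shows "pi w = pi w' \<longleftrightarrow> gp_eq w w'"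
proof
  assume "pi w = pi w'"
  then have "cls (w @ inv_word w') \<in> N" using pi_eq_pi_iff_N assms by blast
  then obtain z where z: "cls (w @ inv_word w') = cls z" "gp_eq z []" using N_subset by auto
  then have "gp_eq (w @ inv_word w') z"
    using cls_eq_iff[of "w @ inv_word w'" z] fp_rel_imp_gp_eq gp_eq_words assms by auto
  with z(2) have "gp_eq (w @ inv_word w') []" using gp_eq.trans by blast
  then have "gp_eq (w @ inv_word w' @ w') w'"
    using gp_eq_append[of "w @ inv_word w'" "[]" w' w'] assms by (simp add: gp_eq.refl)
  moreover have "gp_eq (w @ inv_word w' @ w') w"
    using gp_eq_append[of w w "inv_word w' @ w'" "[]"] gp_eq_inv_word assms by (simp add: gp_eq.refl)
  ultimately show "gp_eq w w'" using gp_eq.sym gp_eq.trans by blast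
qed (rule gp_eq_imp_pi)

lemma pi_inv_word: "w \<in> W \<Longrightarrow> pi (inv_word w) = inv\<^bsub>Q\<^esub> pi w"
  using gp_eq_imp_pi[OF gp_eq_inv_word, of w]
  by (intro Q.inv_equality[symmetric]) (auto simp: pi_append pi_Nil)

subsection \<open>Normal forms\<close>

text \<open>
  \<open>front_val v w\<close> is the letter at \<open>v\<close> that can be shuffled to the front of \<open>w\<close> (trivial if
  there is none) and \<open>front_rest v w\<close> is what it leaves behind.
\<close>

primrec front_val :: "'v \<Rightarrow> ('v \<times> 'a) list \<Rightarrow> 'a" where
  "front_val v [] = \<one>\<^bsub>G v\<^esub>"
| "front_val v (x # w) =
    (if fst x = v then snd x else if adj (fst x) v then front_val v w else \<one>\<^bsub>G v\<^esub>)"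

primrec front_rest :: "'v \<Rightarrow> ('v \<times> 'a) list \<Rightarrow> ('v \<times> 'a) list" where
  "front_rest v [] = []"
| "front_rest v (x # w) =
    (if fst x = v then w else if adj (fst x) v then x # front_rest v w else x # w)"

definition push :: "'v \<Rightarrow> 'a \<Rightarrow> ('v \<times> 'a) list \<Rightarrow> ('v \<times> 'a) list" where
  "push v g w = (if g = \<one>\<^bsub>G v\<^esub> then w else (v, g) # w)"

text \<open>Left multiplication of a reduced word by a letter: the letter absorbs the front letter
  with its label, if there is one, and disappears if the product is trivial.\<close>

definition act :: "'v \<times> 'a \<Rightarrow> ('v \<times> 'a) list \<Rightarrow> ('v \<times> 'a) list" where
  "act x w = push (fst x) (snd x \<otimes>\<^bsub>G (fst x)\<^esub> front_val (fst x) w) (front_rest (fst x) w)"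

definition nf :: "('v \<times> 'a) list \<Rightarrow> ('v \<times> 'a) list" where
  "nf w = foldr act w []"

text \<open>A reduced tail has non-trivial letters only, so a trivial \<open>front_val\<close> says
  that no letter of the tail can be shuffled next to \<open>x\<close> and merged with it.\<close>

primrec reduced :: "('v \<times> 'a) list \<Rightarrow> bool" where
  "reduced [] \<longleftrightarrow> True"
| "reduced (x # w) \<longleftrightarrow>
    snd x \<noteq> \<one>\<^bsub>G (fst x)\<^esub> \<and> front_val (fst x) w = \<one>\<^bsub>G (fst x)\<^esub> \<and> reduced w"

text \<open>Reduced words for the same element are unique only up to exchanging neighbouring letters
  with adjacent labels, so normal forms are compared by this relation instead of equality.\<close>

inductive shuffle :: "('v \<times> 'a) list \<Rightarrow> ('v \<times> 'a) list \<Rightarrow> bool" where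
  swap: "adj (fst x) (fst y) \<Longrightarrow> shuffle (x # y # w) (y # x # w)"
| Cons: "shuffle w w' \<Longrightarrow> shuffle (x # w) (x # w')"
| refl: "shuffle w w"
| trans: "shuffle w w' \<Longrightarrow> shuffle w' w'' \<Longrightarrow> shuffle w w''"

lemma shuffle_sym: "shuffle w w' \<Longrightarrow> shuffle w' w"
  by (induction rule: shuffle.induct) (blast intro: shuffle.intros adj_sym)+

lemma shuffle_length_filter:
  "shuffle w w' \<Longrightarrow> length (filter P w) = length (filter P w')"
  by (induction rule: shuffle.induct) auto

lemma front_val_closed [simp]: "v \<in> V \<Longrightarrow> w \<in> W \<Longrightarrow> front_val v w \<in> carrier (G v)"
  by (induction w) auto

lemma front_rest_words [simp]: "w \<in> W \<Longrightarrow> front_rest v w \<in> W"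
  by (induction w) auto

lemma push_words: "v \<in> V \<Longrightarrow> g \<in> carrier (G v) \<Longrightarrow> w \<in> W \<Longrightarrow> push v g w \<in> W"
  by (simp add: push_def)

lemma act_words: "x # w \<in> W \<Longrightarrow> act x w \<in> W"
  by (simp add: act_def push_words)

lemma foldr_act_words: "w \<in> W \<Longrightarrow> z \<in> W \<Longrightarrow> foldr act w z \<in> W"
  by (induction w) (auto intro: act_words)

lemma front_rest_trivial:
  "reduced w \<Longrightarrow> front_val v w = \<one>\<^bsub>G v\<^esub> \<Longrightarrow> front_rest v w = w"
  by (induction w) (auto split: if_splits)

lemma front_val_push_self:
  "front_val v w = \<one>\<^bsub>G v\<^esub> \<Longrightarrow> front_val v (push v g w) = g"
  by (simp add: push_def)

lemma front_rest_push_self: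
  "reduced w \<Longrightarrow> front_val v w = \<one>\<^bsub>G v\<^esub> \<Longrightarrow> front_rest v (push v g w) = w"
  by (simp add: push_def front_rest_trivial)

lemma front_val_push_adj: "adj u v \<Longrightarrow> front_val v (push u g w) = front_val v w"
  using adj_vertices by (auto simp: push_def)

lemma front_rest_push_adj: "adj u v \<Longrightarrow> front_rest v (push u g w) = push u g (front_rest v w)"
  using adj_vertices by (auto simp: push_def)

lemma reduced_push:
  "reduced w \<Longrightarrow> front_val v w = \<one>\<^bsub>G v\<^esub> \<Longrightarrow> reduced (push v g w)"
  by (simp add: push_def)

lemma shuffle_push: "shuffle w w' \<Longrightarrow> shuffle (push v g w) (push v g w')"
  by (simp add: push_def shuffle.Cons)

lemma shuffle_push_push:
  "adj u v \<Longrightarrow> shuffle (push u g (push v h w)) (push v h (push u g w))"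
  by (simp add: push_def shuffle.swap shuffle.refl)

lemma shuffle_front:
  "shuffle w w' \<Longrightarrow> front_val v w = front_val v w' \<and> shuffle (front_rest v w) (front_rest v w')"
proof (induction rule: shuffle.induct)
  case (swap x y w)
  then show ?case
    using adj_vertices[OF swap] adj_sym[OF swap] by (auto intro: shuffle.intros)
next
  case (Cons w w' x)
  then show ?case by (auto intro: shuffle.Cons)
next
  case (refl w)
  then show ?case by (auto intro: shuffle.refl)
next
  case (trans w w' w'')
  then show ?case by (auto intro: shuffle.trans)
qed

lemma reduced_front:
  "reduced w \<Longrightarrow> reduced (front_rest v w) \<and> front_val v (front_rest v w) = \<one>\<^bsub>G v\<^esub>
    \<and> shuffle w (push v (front_val v w) (front_rest v w))"
proof (induction w)
  case Nil
  then show ?case by (simp add: push_def shuffle.refl)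
next
  case (Cons x w)
  let ?h = "front_val v w" and ?w = "front_rest v w"
  from Cons have w: "reduced w" "reduced ?w" "front_val v ?w = \<one>\<^bsub>G v\<^esub>"
    and sh: "shuffle w (push v ?h ?w)" by auto
  consider "fst x = v" | "fst x \<noteq> v" "adj (fst x) v" | "fst x \<noteq> v" "\<not> adj (fst x) v" by blast
  then show ?case
  proof cases
    case 1
    then show ?thesis using Cons.prems by (cases x) (auto simp: push_def shuffle.refl)
  next
    case 2
    \<comment> \<open>Front letters are invariant under \<open>shuffle\<close>, and a letter at
      \<open>v\<close> is transparent for the adjacent label of \<open>x\<close>. So
      \<open>x\<close> still has nothing to merge with once the letter at \<open>v\<close> is taken
      out.\<close>
    have "front_val (fst x) (push v ?h ?w) = \<one>\<^bsub>G (fst x)\<^esub>"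
      using shuffle_front[OF sh, of "fst x"] Cons.prems by simp
    then have "front_val (fst x) ?w = \<one>\<^bsub>G (fst x)\<^esub>"
      using front_val_push_adj[OF adj_sym] 2 by simp
    then have "reduced (x # ?w)" using Cons.prems w by simp
    moreover have "shuffle (x # w) (push v ?h (x # ?w))"
    proof (rule shuffle.trans)
      show "shuffle (x # w) (x # push v ?h ?w)" using sh by (rule shuffle.Cons)
      show "shuffle (x # push v ?h ?w) (push v ?h (x # ?w))"
        using 2 by (auto simp: push_def intro: shuffle.intros)
    qed
    ultimately show ?thesis using 2 w by simp
  next
    case 3
    then show ?thesis using Cons.prems by (simp add: push_def shuffle.refl)
  qed
qed

lemma reduced_act: "reduced w \<Longrightarrow> reduced (act x w)"
  using reduced_front by (simp add: act_def reduced_push)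

lemma reduced_foldr_act: "reduced z \<Longrightarrow> reduced (foldr act w z)"
  by (induction w) (auto intro: reduced_act)

lemma reduced_nf: "reduced (nf w)"
  by (simp add: nf_def reduced_foldr_act)

lemma shuffle_act: "shuffle w w' \<Longrightarrow> shuffle (act x w) (act x w')"
  using shuffle_front by (simp add: act_def shuffle_push)

lemma shuffle_foldr_act: "shuffle z z' \<Longrightarrow> shuffle (foldr act w z) (foldr act w z')"
  by (induction w) (auto intro: shuffle_act)

lemma act_one:
  assumes "v \<in> V" "w \<in> W" "reduced w"
  shows "shuffle (act (v, \<one>\<^bsub>G v\<^esub>) w) w"
proof -
  interpret Gv: group "G v" using assms(1) by (rule vertex_group)
  show ?thesis using reduced_front[OF assms(3), of v] assms by (simp add: act_def shuffle_sym)
qed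

lemma act_mult:
  assumes "v \<in> V" "g \<in> carrier (G v)" "h \<in> carrier (G v)" "w \<in> W" "reduced w"
  shows "act (v, g) (act (v, h) w) = act (v, g \<otimes>\<^bsub>G v\<^esub> h) w"
proof -
  interpret Gv: group "G v" using assms(1) by (rule vertex_group)
  show ?thesis using reduced_front[OF assms(5), of v] assms
    by (simp add: act_def front_val_push_self front_rest_push_self Gv.m_assoc)
qed

lemma front_commute:
  assumes "adj u v"
  shows "front_val u (front_rest v w) = front_val u w"
    and "front_rest u (front_rest v w) = front_rest v (front_rest u w)"
  using adj_vertices[OF assms] adj_sym[OF assms] assms by (induction w) auto

lemma act_comm:
  assumes "adj u v"
  shows "shuffle (act (u, g) (act (v, h) w)) (act (v, h) (act (u, g) w))"
  using assms adj_sym[OF assms]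
  by (simp add: act_def front_val_push_adj front_rest_push_adj front_commute shuffle_push_push)

text \<open>Van der Waerden's argument: letters act on reduced words modulo \<open>shuffle\<close>,
  and \<open>act_one\<close>, \<open>act_mult\<close> and \<open>act_comm\<close> verify the
  defining relations for this action. Equivalent words therefore act alike, in particular on the
  empty word, which is sent to the normal form.\<close>

lemma gp_eq_imp_shuffle_nf: "gp_eq w w' \<Longrightarrow> shuffle (nf w) (nf w')"
proof (induction rule: gp_eq.induct)
  case (one v xs ys)
  have "shuffle (act (v, \<one>\<^bsub>G v\<^esub>) (nf ys)) (nf ys)"
    using one by (intro act_one reduced_nf) (auto simp: nf_def foldr_act_words)
  then show ?case by (auto simp: nf_def intro: shuffle_foldr_act)
next
  case (mult v g h xs ys)
  have "act (v, g) (act (v, h) (nf ys)) = act (v, g \<otimes>\<^bsub>G v\<^esub> h) (nf ys)"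
    using mult by (intro act_mult reduced_nf) (auto simp: nf_def foldr_act_words)
  then show ?case by (simp add: nf_def shuffle.refl)
next
  case (comm u v g h xs ys)
  then show ?case by (auto simp: nf_def intro: shuffle_foldr_act act_comm)
qed (auto intro: shuffle.refl shuffle_sym shuffle.trans)

lemma reduced_act_Cons:
  assumes "x # w \<in> W" "reduced (x # w)"
  shows "act x w = x # w"
proof -
  obtain v g where x: "x = (v, g)" by force
  interpret Gv: group "G v" using assms x by (intro vertex_group) auto
  show ?thesis using assms x by (simp add: act_def front_rest_trivial push_def)
qed

lemma nf_reduced: "w \<in> W \<Longrightarrow> reduced w \<Longrightarrow> nf w = w"
  by (induction w) (auto simp: nf_def reduced_act_Cons)

section \<open>Letter counts of normal forms\<close>

definition count_letters :: "('v \<times> 'a \<Rightarrow> bool) \<Rightarrow> ('v \<times> 'a) list \<Rightarrow> nat" where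
  "count_letters P w = length (filter P (nf w))"

text \<open>Normal forms of equal elements differ by a shuffle, which only permutes letters. The
  count is thus an invariant of the group element; for the constantly true predicate it is the word
  length.\<close>

lemma count_letters_cong: "pi w = pi w' \<Longrightarrow> w \<in> W \<Longrightarrow> w' \<in> W \<Longrightarrow> count_letters P w = count_letters P w'"
  using gp_eq_imp_shuffle_nf shuffle_length_filter pi_eq_iff unfolding count_letters_def by blast

lemma length_filter_front_rest:
  "length (filter P (front_rest v w)) \<le> length (filter P w)"
  "length (filter P w) \<le> Suc (length (filter P (front_rest v w)))"
  by (induction w) auto

text \<open>Acting with a letter removes at most one letter and adds at most one, so the count
  changes by at most one for each letter of \<open>z\<close>.\<close>

lemma count_letters_append:
  "count_letters P w \<le> count_letters P (z @ w) + length z"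
  "count_letters P (z @ w) \<le> count_letters P w + length z"
proof -
  have act: "length (filter P w) \<le> Suc (length (filter P (act x w)))"
    "length (filter P (act x w)) \<le> Suc (length (filter P w))" for x w
    using length_filter_front_rest[where P = P and v = "fst x" and w = w] by (auto simp: act_def push_def)
  show "count_letters P w \<le> count_letters P (z @ w) + length z"
    by (induction z) (use act(1) in \<open>auto simp: count_letters_def nf_def intro: order.trans\<close>)
  show "count_letters P (z @ w) \<le> count_letters P w + length z"
    by (induction z) (use act(2) in \<open>auto simp: count_letters_def nf_def intro: order.trans\<close>)
qed

lemma front_val_append:
  "front_val v (k @ z) = (if \<forall>y\<in>set k. adj (fst y) v then front_val v z else front_val v k)"
  using adj_vertices by (induction k) auto

text \<open>A merge across the boundary needs a letter of \<open>k\<close> that commutes past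
  everything behind it in \<open>k\<close> and a front letter of \<open>z\<close> with the same
  label. The third assumption excludes this.\<close>

lemma reduced_append_right:
  assumes "reduced k" "reduced z"
    and "\<And>m x s. k = m @ x # s \<Longrightarrow> \<forall>y\<in>set s. adj (fst y) (fst x)
      \<Longrightarrow> front_val (fst x) z = \<one>\<^bsub>G (fst x)\<^esub>"
  shows "reduced (k @ z)"
  using assms
proof (induction k)
  case (Cons y k)
  have "reduced (k @ z)"
  proof (rule Cons.IH)
    show "reduced k" "reduced z" using Cons.prems by auto
    show "front_val (fst x) z = \<one>\<^bsub>G (fst x)\<^esub>"
      if "k = m @ x # s" "\<forall>y\<in>set s. adj (fst y) (fst x)" for m x s
      using Cons.prems(3)[of "y # m" x s] that by simp
  qed
  moreover have "front_val (fst y) (k @ z) = \<one>\<^bsub>G (fst y)\<^esub>"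
    using Cons.prems(1) Cons.prems(3)[of "[]" y k] by (auto simp: front_val_append)
  ultimately show ?case using Cons.prems by simp
qed simp

lemma reduced_nontrivial: "reduced w \<Longrightarrow> x \<in> set w \<Longrightarrow> snd x \<noteq> \<one>\<^bsub>G (fst x)\<^esub>"
  by (induction w) auto

lemma labels_inv_word: "fst ` set (inv_word w) = fst ` set w"
  by (induction w) auto

lemma labels_inv_word_iff: "(\<forall>y\<in>set (inv_word w). P (fst y)) \<longleftrightarrow> (\<forall>y\<in>set w. P (fst y))"
  using labels_inv_word[of w] by (metis (no_types, lifting) imageE imageI)

lemma inv_word_eq_append:
  assumes "w \<in> W" "inv_word w = m @ x # s"
  shows "w = inv_word s @ (fst x, inv\<^bsub>G (fst x)\<^esub> snd x) # inv_word m"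
  using inv_word_inv_word[OF assms(1)] assms(2) by simp

text \<open>A letter that can be shuffled to the end of the inverse word is the inverse of a front
  letter of the original one. If it could merge with the inverse of \<open>x\<close>, then
  \<open>x\<close> could already merge with a letter of \<open>w\<close>.\<close>

lemma reduced_inv_word:
  "w \<in> W \<Longrightarrow> reduced w \<Longrightarrow> reduced (inv_word w)"
proof (induction w)
  case (Cons x w)
  obtain v g where x: "x = (v, g)" by force
  have v: "v \<in> V" "g \<in> carrier (G v)" "g \<noteq> \<one>\<^bsub>G v\<^esub>" using Cons.prems x by auto
  interpret Gv: group "G v" using v(1) by (rule vertex_group)
  have "reduced (inv_word w @ [(v, inv\<^bsub>G v\<^esub> g)])"
  proof (rule reduced_append_right)
    show "reduced (inv_word w)" using Cons by simp
    show "reduced [(v, inv\<^bsub>G v\<^esub> g)]" using v Gv.inv_eq_1_iff by simp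
  next
    fix m y s assume m: "inv_word w = m @ y # s" "\<forall>z\<in>set s. adj (fst z) (fst y)"
    have w: "w = inv_word s @ (fst y, inv\<^bsub>G (fst y)\<^esub> snd y) # inv_word m"
      using Cons.prems m by (intro inv_word_eq_append) auto
    then have ne: "inv\<^bsub>G (fst y)\<^esub> snd y \<noteq> \<one>\<^bsub>G (fst y)\<^esub>"
      using Cons.prems reduced_nontrivial[of w "(fst y, inv\<^bsub>G (fst y)\<^esub> snd y)"] by auto
    have "fst y \<noteq> v"
    proof
      assume "fst y = v"
      then have "front_val v w = inv\<^bsub>G v\<^esub> snd y"
        using m(2) labels_inv_word_iff[of s "\<lambda>u. adj u v"]
        unfolding w by (subst front_val_append) simp
      then show False using Cons.prems x ne \<open>fst y = v\<close> by simp
    qed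
    then show "front_val (fst y) [(v, inv\<^bsub>G v\<^esub> g)] = \<one>\<^bsub>G (fst y)\<^esub>" by simp
  qed
  then show ?case using x by simp
qed simp

lemma gp_eq_ConsI: "gp_eq w w' \<Longrightarrow> v \<in> V \<Longrightarrow> g \<in> carrier (G v) \<Longrightarrow> gp_eq ((v, g) # w) ((v, g) # w')"
  using gp_eq_context[of w w' "[(v, g)]" "[]"] by simp

lemma gp_eq_front: "v \<in> V \<Longrightarrow> w \<in> W \<Longrightarrow> gp_eq w ((v, front_val v w) # front_rest v w)"
proof (induction w)
  case Nil
  then show ?case using gp_eq.one[of v "[]" "[]"] by (simp add: gp_eq.sym)
next
  case (Cons x w)
  obtain u g where x: "x = (u, g)" by force
  have u: "u \<in> V" "g \<in> carrier (G u)" "w \<in> W" using Cons.prems x by auto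
  consider "u = v" | "u \<noteq> v" "adj u v" | "u \<noteq> v" "\<not> adj u v" by blast
  then show ?case
  proof cases
    case 1
    then show ?thesis using Cons.prems x by (auto intro: gp_eq.refl)
  next
    case 2
    have "gp_eq (x # w) (x # (v, front_val v w) # front_rest v w)"
      using Cons.IH[OF Cons.prems(1) u(3)] u x by (simp add: gp_eq_ConsI)
    moreover have "gp_eq (x # (v, front_val v w) # front_rest v w) ((v, front_val v w) # x # front_rest v w)"
      using gp_eq.comm[of u v g "front_val v w" "[]" "front_rest v w"] 2 u x Cons.prems by simp
    ultimately show ?thesis using 2 x gp_eq.trans by simp
  next
    case 3
    then show ?thesis using gp_eq.one[of v "[]" "x # w"] Cons.prems x by (simp add: gp_eq.sym)
  qed
qed

lemma gp_eq_act:
  assumes "x # w \<in> W"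
  shows "gp_eq (x # w) (act x w)"
proof -
  obtain v g where x: "x = (v, g)" by force
  have v: "v \<in> V" "g \<in> carrier (G v)" "w \<in> W" using assms x by auto
  let ?h = "g \<otimes>\<^bsub>G v\<^esub> front_val v w" and ?w = "front_rest v w"
  have "gp_eq (x # w) (x # (v, front_val v w) # ?w)"
    using v x by (simp add: gp_eq_ConsI gp_eq_front)
  moreover have "gp_eq (x # (v, front_val v w) # ?w) ((v, ?h) # ?w)"
    using gp_eq.mult[of v g "front_val v w" "[]" ?w] v x by simp
  moreover have "gp_eq ((v, ?h) # ?w) (push v ?h ?w)"
    using gp_eq.one[of v "[]" ?w] v by (auto simp: push_def gp_eq.refl)
  ultimately have "gp_eq (x # w) (push v ?h ?w)" by (blast intro: gp_eq.trans)
  then show ?thesis using x by (simp add: act_def)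
qed

lemma nf_words: "w \<in> W \<Longrightarrow> nf w \<in> W"
  by (simp add: nf_def foldr_act_words)

lemma gp_eq_nf: "w \<in> W \<Longrightarrow> gp_eq w (nf w)"
proof (induction w)
  case Nil
  then show ?case by (simp add: nf_def gp_eq.refl)
next
  case (Cons x w)
  then have "gp_eq (x # w) (x # nf w)" using gp_eq_ConsI by (cases x) auto
  moreover have "gp_eq (x # nf w) (act x (nf w))"
    using Cons.prems nf_words by (intro gp_eq_act) auto
  ultimately show ?case by (auto simp: nf_def intro: gp_eq.trans)
qed

lemma pi_nf: "w \<in> W \<Longrightarrow> pi (nf w) = pi w"
  using gp_eq_imp_pi gp_eq_nf by metis

lemma count_letters_reduced: "w \<in> W \<Longrightarrow> reduced w \<Longrightarrow> count_letters P w = length (filter P w)"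
  by (simp add: count_letters_def nf_reduced)

text \<open>The inverse of a normal form is again reduced, so its letters can be counted directly:
  they are the inverses of the original letters.\<close>

lemma count_letters_inv_word:
  assumes "w \<in> W"
  shows "count_letters P (inv_word w) = count_letters (\<lambda>x. P (fst x, inv\<^bsub>G (fst x)\<^esub> (snd x))) w"
proof -
  have "pi (inv_word w) = pi (inv_word (nf w))"
    using assms by (simp add: pi_inv_word pi_nf nf_words)
  then have "count_letters P (inv_word w) = count_letters P (inv_word (nf w))"
    using assms nf_words by (intro count_letters_cong) auto
  also have "\<dots> = length (filter P (inv_word (nf w)))"
    using assms by (intro count_letters_reduced inv_word_words reduced_inv_word nf_words reduced_nf)
  also have "\<dots> = length (filter (\<lambda>x. P (fst x, inv\<^bsub>G (fst x)\<^esub> (snd x))) (nf w))"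
    by (simp add: inv_word_def rev_filter[symmetric] filter_map o_def)
  finally show ?thesis by (simp add: count_letters_def)
qed

text \<open>Normal forms are built by multiplication from the left, so multiplication from the right
  is reduced to it by inversion.\<close>

lemma count_letters_append_right:
  assumes "w \<in> W" "z \<in> W"
  shows "count_letters P w \<le> count_letters P (w @ z) + length z"
proof -
  let ?P = "\<lambda>x. P (fst x, inv\<^bsub>G (fst x)\<^esub> (snd x))"
  have "count_letters P w = count_letters ?P (inv_word w)"
    using count_letters_inv_word[of "inv_word w" P] assms by (simp add: inv_word_inv_word)
  moreover have "count_letters P (w @ z) = count_letters ?P (inv_word z @ inv_word w)"
    using count_letters_inv_word[of "inv_word (w @ z)" P] assms
    by (simp add: inv_word_inv_word del: inv_word_simps(3)) simp
  ultimately show ?thesis using count_letters_append(1)[of ?P "inv_word w" "inv_word z"] by simp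
qed

lemma concat_replicate_words [simp]: "w \<in> W \<Longrightarrow> concat (replicate n w) \<in> W"
  by (induction n) auto

lemma Q_cancel:
  assumes "x \<in> carrier Q" "y \<in> carrier Q"
  shows "x \<otimes>\<^bsub>Q\<^esub> (inv\<^bsub>Q\<^esub> x \<otimes>\<^bsub>Q\<^esub> y) = y" "inv\<^bsub>Q\<^esub> x \<otimes>\<^bsub>Q\<^esub> (x \<otimes>\<^bsub>Q\<^esub> y) = y"
  using assms by (simp_all add: Q.m_assoc[symmetric])

lemmas Q_simps = Q.m_assoc Q_cancel Q.inv_mult_group pi_append pi_inv_word pi_Nil

lemma pi_concat_replicate_conj:
  assumes "w \<in> W" "w' \<in> W" "z \<in> W" "pi w' = pi (z @ w @ inv_word z)"
  shows "pi (concat (replicate n w')) = pi (z @ concat (replicate n w) @ inv_word z)"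
  using assms by (induction n) (simp_all add: Q_simps)

text \<open>A power of a conjugate is the conjugate of the power, so the error
  \<open>2 * length z\<close> is independent of \<open>n\<close>. Growth rates of letter counts in
  powers are thereby conjugacy invariants.\<close>

lemma count_letters_conj_powers:
  assumes "w \<in> W" "w' \<in> W" "z \<in> W" "pi w' = pi (z @ w @ inv_word z)"
  shows "count_letters P (concat (replicate n w))
    \<le> count_letters P (concat (replicate n w')) + 2 * length z"
proof -
  let ?w = "concat (replicate n w)"
  have "count_letters P ?w \<le> count_letters P (z @ ?w) + length z"
    by (rule count_letters_append)
  also have "count_letters P (z @ ?w) \<le> count_letters P ((z @ ?w) @ inv_word z) + length (inv_word z)"
    using assms by (intro count_letters_append_right) auto
  also have "count_letters P ((z @ ?w) @ inv_word z) = count_letters P (concat (replicate n w'))"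
    using assms pi_concat_replicate_conj[OF assms] by (intro count_letters_cong) auto
  finally show ?thesis by simp
qed

lemma count_letters_le_length: "count_letters P w \<le> length w"
  using count_letters_append(2)[of P w "[]"] by (simp add: count_letters_def nf_def)

subsection \<open>Letters and parabolic subgroups\<close>

definition star :: "'v \<Rightarrow> 'v set" where
  "star v = {u. u = v \<or> adj u v}"

definition parabolic :: "'v set \<Rightarrow> ('v \<times> 'a) list set set set" where
  "parabolic S = pi ` {w \<in> W. fst ` set w \<subseteq> S}"

definition letter :: "'v \<Rightarrow> 'a \<Rightarrow> ('v \<times> 'a) list set set" where
  "letter v g = pi [(v, g)]"

text \<open>On words, the retraction of the graph product onto the vertex group at \<open>v\<close>
  that kills all other vertex groups; it is well defined by \<open>eval_cong\<close>.\<close>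

primrec eval :: "'v \<Rightarrow> ('v \<times> 'a) list \<Rightarrow> 'a" where
  "eval v [] = \<one>\<^bsub>G v\<^esub>"
| "eval v (x # w) = (if fst x = v then snd x \<otimes>\<^bsub>G v\<^esub> eval v w else eval v w)"

lemma letter_closed [simp]: "v \<in> V \<Longrightarrow> g \<in> carrier (G v) \<Longrightarrow> letter v g \<in> carrier Q"
  by (simp add: letter_def)

lemma pi_Cons: "x # w \<in> W \<Longrightarrow> pi (x # w) = letter (fst x) (snd x) \<otimes>\<^bsub>Q\<^esub> pi w"
  using pi_append[of "[x]" w] by (simp add: letter_def)

lemma letter_mult:
  "v \<in> V \<Longrightarrow> g \<in> carrier (G v) \<Longrightarrow> h \<in> carrier (G v) \<Longrightarrow>
    letter v (g \<otimes>\<^bsub>G v\<^esub> h) = letter v g \<otimes>\<^bsub>Q\<^esub> letter v h"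
  using gp_eq_imp_pi[OF gp_eq.mult[of v g h "[]" "[]"]] pi_append[of "[(v, g)]" "[(v, h)]"]
  by (simp add: letter_def)

lemma letter_one: "v \<in> V \<Longrightarrow> letter v \<one>\<^bsub>G v\<^esub> = \<one>\<^bsub>Q\<^esub>"
  using gp_eq_imp_pi[OF gp_eq.one[of v "[]" "[]"]] by (simp add: letter_def pi_Nil)

lemma letter_inv: "v \<in> V \<Longrightarrow> g \<in> carrier (G v) \<Longrightarrow> letter v (inv\<^bsub>G v\<^esub> g) = inv\<^bsub>Q\<^esub> letter v g"
  using pi_inv_word[of "[(v, g)]"] by (simp add: letter_def)

lemma letter_commute:
  "adj u v \<Longrightarrow> g \<in> carrier (G u) \<Longrightarrow> h \<in> carrier (G v) \<Longrightarrow>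
    letter u g \<otimes>\<^bsub>Q\<^esub> letter v h = letter v h \<otimes>\<^bsub>Q\<^esub> letter u g"
  using gp_eq_imp_pi[OF gp_eq.comm[of u v g h "[]" "[]"]] adj_vertices[of u v]
    pi_append[of "[(u, g)]" "[(v, h)]"] pi_append[of "[(v, h)]" "[(u, g)]"]
  by (simp add: letter_def)

lemma eval_closed [simp]: "v \<in> V \<Longrightarrow> w \<in> W \<Longrightarrow> eval v w \<in> carrier (G v)"
  by (induction w) auto

lemma eval_append:
  assumes "v \<in> V" "w \<in> W" "z \<in> W"
  shows "eval v (w @ z) = eval v w \<otimes>\<^bsub>G v\<^esub> eval v z"
proof -
  interpret Gv: group "G v" using assms(1) by (rule vertex_group)
  show ?thesis using assms(2) by (induction w) (use assms in \<open>auto simp: Gv.m_assoc\<close>)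
qed

lemma eval_cong:
  assumes "v \<in> V" "pi w = pi w'" "w \<in> W" "w' \<in> W"
  shows "eval v w = eval v w'"
proof -
  interpret Gv: group "G v" using assms(1) by (rule vertex_group)
  have "gp_eq w w'" using assms pi_eq_iff by blast
  then show ?thesis
  proof induction
    case (comm u u' g h xs ys)
    then show ?case
      using adj_vertices[OF comm(1)] assms(1) by (cases "u = v"; cases "u' = v") (auto simp: eval_append)
  qed (auto simp: eval_append assms(1) Gv.m_assoc)
qed

lemma eval_inv_word:
  assumes "v \<in> V" "w \<in> W"
  shows "eval v (inv_word w) = inv\<^bsub>G v\<^esub> eval v w"
proof -
  interpret Gv: group "G v" using assms(1) by (rule vertex_group)
  have "eval v (inv_word w @ w) = eval v []"
    using gp_eq_imp_pi[OF gp_eq_inv_word] assms by (intro eval_cong) auto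
  then show ?thesis using assms by (intro Gv.inv_equality[symmetric]) (auto simp: eval_append)
qed

lemma letter_inject:
  assumes "v \<in> V" "g \<in> carrier (G v)" "h \<in> carrier (G v)" "letter v g = letter v h"
  shows "g = h"
proof -
  interpret Gv: group "G v" using assms(1) by (rule vertex_group)
  show ?thesis using eval_cong[of v "[(v, g)]" "[(v, h)]"] assms by (simp add: letter_def)
qed

text \<open>Deleting the letters outside \<open>S\<close> respects every rule of
  \<open>gp_eq\<close>, so it induces the retraction onto the parabolic subgroup of
  \<open>S\<close>.\<close>

lemma filter_labels_cong:
  assumes "pi w = pi w'" "w \<in> W" "w' \<in> W"
  shows "pi (filter (\<lambda>x. fst x \<in> S) w) = pi (filter (\<lambda>x. fst x \<in> S) w')"
proof -
  have "gp_eq w w'" using assms pi_eq_iff by blast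
  then have "gp_eq (filter (\<lambda>x. fst x \<in> S) w) (filter (\<lambda>x. fst x \<in> S) w')"
  proof induction
    case (one v xs ys)
    then show ?case using gp_eq.one[of v] by (auto intro: gp_eq.refl)
  next
    case (mult v g h xs ys)
    then show ?case using gp_eq.mult[of v g h] by (auto intro: gp_eq.refl)
  next
    case (comm u v g h xs ys)
    then show ?case using gp_eq.comm[of u v g h] adj_vertices[OF comm(1)] by (auto intro: gp_eq.refl)
  qed (auto intro: gp_eq.refl gp_eq.sym gp_eq.trans)
  then show ?thesis by (rule gp_eq_imp_pi)
qed

lemma parabolicI: "w \<in> W \<Longrightarrow> fst ` set w \<subseteq> S \<Longrightarrow> pi w \<in> parabolic S"
  by (auto simp: parabolic_def)

lemma parabolicE:
  assumes "q \<in> parabolic S"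
  obtains w where "w \<in> W" "fst ` set w \<subseteq> S" "q = pi w"
  using assms by (auto simp: parabolic_def)

lemma subgroup_parabolic: "subgroup (parabolic S) Q"
proof (rule Q.subgroupI)
  show "parabolic S \<subseteq> carrier Q" by (auto simp: parabolic_def)
  show "parabolic S \<noteq> {}" using parabolicI[of "[]" S] by auto
next
  fix x assume "x \<in> parabolic S"
  then obtain w where "w \<in> W" "fst ` set w \<subseteq> S" "x = pi w" by (rule parabolicE)
  then show "inv\<^bsub>Q\<^esub> x \<in> parabolic S"
    using parabolicI[of "inv_word w" S] by (simp add: labels_inv_word pi_inv_word)
next
  fix x y assume "x \<in> parabolic S" "y \<in> parabolic S"
  then obtain w z where "w \<in> W" "fst ` set w \<subseteq> S" "x = pi w" "z \<in> W" "fst ` set z \<subseteq> S" "y = pi z"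
    by (auto elim!: parabolicE)
  then show "x \<otimes>\<^bsub>Q\<^esub> y \<in> parabolic S"
    using parabolicI[of "w @ z" S] by (auto simp: pi_append)
qed

lemma parabolic_mult: "x \<in> parabolic S \<Longrightarrow> y \<in> parabolic S \<Longrightarrow> x \<otimes>\<^bsub>Q\<^esub> y \<in> parabolic S"
  using subgroup_parabolic by (rule subgroup.m_closed)

lemma parabolic_inv: "x \<in> parabolic S \<Longrightarrow> inv\<^bsub>Q\<^esub> x \<in> parabolic S"
  using subgroup_parabolic by (rule subgroup.m_inv_closed)

lemma parabolic_closed: "x \<in> parabolic S \<Longrightarrow> x \<in> carrier Q"
  using subgroup_parabolic by (rule subgroup.mem_carrier)

lemma letter_parabolic: "v \<in> V \<Longrightarrow> g \<in> carrier (G v) \<Longrightarrow> v \<in> S \<Longrightarrow> letter v g \<in> parabolic S"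
  unfolding letter_def by (rule parabolicI) auto

text \<open>Letters at neighbours of \<open>u\<close> commute with \<open>letter u g\<close>, and
  letters at \<open>u\<close> conjugate it inside the vertex group.\<close>

lemma parabolic_star_conj_letter:
  assumes "u \<in> V" "g \<in> carrier (G u)" "s \<in> parabolic (star u)"
  shows "\<exists>g'\<in>carrier (G u). conjugate_in (G u) g' g
    \<and> s \<otimes>\<^bsub>Q\<^esub> letter u g \<otimes>\<^bsub>Q\<^esub> inv\<^bsub>Q\<^esub> s = letter u g'"
proof -
  interpret Gu: group "G u" using assms(1) by (rule vertex_group)
  obtain w where w: "w \<in> W" "fst ` set w \<subseteq> star u" "s = pi w"
    using assms(3) by (rule parabolicE)
  have "\<exists>c\<in>carrier (G u). pi w \<otimes>\<^bsub>Q\<^esub> letter u g \<otimes>\<^bsub>Q\<^esub> inv\<^bsub>Q\<^esub> pi w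
      = letter u (c \<otimes>\<^bsub>G u\<^esub> g \<otimes>\<^bsub>G u\<^esub> inv\<^bsub>G u\<^esub> c)"
    using w(1,2)
  proof (induction w)
    case Nil
    then show ?case using assms by (intro bexI[of _ "\<one>\<^bsub>G u\<^esub>"]) (auto simp: pi_Nil)
  next
    case (Cons x w)
    obtain v h where x: "x = (v, h)" by force
    have v: "v \<in> V" "h \<in> carrier (G v)" "w \<in> W" using Cons.prems x by auto
    obtain c where c: "c \<in> carrier (G u)" "pi w \<otimes>\<^bsub>Q\<^esub> letter u g \<otimes>\<^bsub>Q\<^esub> inv\<^bsub>Q\<^esub> pi w
      = letter u (c \<otimes>\<^bsub>G u\<^esub> g \<otimes>\<^bsub>G u\<^esub> inv\<^bsub>G u\<^esub> c)" (is "_ = letter u ?k")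
      using Cons by auto
    have k: "?k \<in> carrier (G u)" using c assms by simp
    have "pi (x # w) \<otimes>\<^bsub>Q\<^esub> letter u g \<otimes>\<^bsub>Q\<^esub> inv\<^bsub>Q\<^esub> pi (x # w)
        = letter v h \<otimes>\<^bsub>Q\<^esub> (pi w \<otimes>\<^bsub>Q\<^esub> letter u g \<otimes>\<^bsub>Q\<^esub> inv\<^bsub>Q\<^esub> pi w) \<otimes>\<^bsub>Q\<^esub> inv\<^bsub>Q\<^esub> letter v h"
      using v x assms by (simp add: pi_Cons Q.m_assoc Q.inv_mult_group)
    also have "\<dots> = letter v h \<otimes>\<^bsub>Q\<^esub> letter u ?k \<otimes>\<^bsub>Q\<^esub> inv\<^bsub>Q\<^esub> letter v h" using c by simp
    finally have eq: "pi (x # w) \<otimes>\<^bsub>Q\<^esub> letter u g \<otimes>\<^bsub>Q\<^esub> inv\<^bsub>Q\<^esub> pi (x # w) = \<dots>" .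
    show ?case
    proof (cases "v = u")
      case True
      then have "letter v h \<otimes>\<^bsub>Q\<^esub> letter u ?k \<otimes>\<^bsub>Q\<^esub> inv\<^bsub>Q\<^esub> letter v h
          = letter u (h \<otimes>\<^bsub>G u\<^esub> ?k \<otimes>\<^bsub>G u\<^esub> inv\<^bsub>G u\<^esub> h)"
        using v k by (simp add: letter_mult letter_inv)
      also have "h \<otimes>\<^bsub>G u\<^esub> ?k \<otimes>\<^bsub>G u\<^esub> inv\<^bsub>G u\<^esub> h
          = (h \<otimes>\<^bsub>G u\<^esub> c) \<otimes>\<^bsub>G u\<^esub> g \<otimes>\<^bsub>G u\<^esub> inv\<^bsub>G u\<^esub> (h \<otimes>\<^bsub>G u\<^esub> c)"
        using v c assms True by (simp add: Gu.m_assoc Gu.inv_mult_group)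
      finally show ?thesis using eq True v c by (intro bexI[of _ "h \<otimes>\<^bsub>G u\<^esub> c"]) auto
    next
      case False
      then have "adj v u" using Cons.prems x by (auto simp: star_def)
      then have "letter v h \<otimes>\<^bsub>Q\<^esub> letter u ?k \<otimes>\<^bsub>Q\<^esub> inv\<^bsub>Q\<^esub> letter v h = letter u ?k"
        using letter_commute[of v u h ?k] v k assms by (simp add: Q.m_assoc)
      then show ?thesis using eq c by auto
    qed
  qed
  then show ?thesis using w assms by (fastforce simp: conjugate_in_def)
qed

text \<open>
  For a shortest element \<open>k\<close> of the double coset of \<open>t\<close>, the given element is conjugate to some
  \<open>a' k b' k'\<close>, with \<open>k'\<close> the inverse of \<open>k\<close>, all of whose powers are reduced as written if
  \<open>k\<close> is non-trivial. So the length of the \<open>n\<close>-th power grows like \<open>n (2 + 2 |k|)\<close>, whereas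
  conjugates of a product of two letters only allow \<open>2 n\<close> up to a constant.
\<close>

lemma star_double_coset:
  assumes uv: "u \<in> V" "v \<in> V"
    and a: "a \<in> carrier (G u)" "a \<noteq> \<one>\<^bsub>G u\<^esub>" and b: "b \<in> carrier (G v)" "b \<noteq> \<one>\<^bsub>G v\<^esub>"
    and cd: "[c, d] \<in> W" and t: "t \<in> carrier Q" and z: "z \<in> carrier Q"
    and eq: "pi [c, d] = z \<otimes>\<^bsub>Q\<^esub> (letter u a \<otimes>\<^bsub>Q\<^esub> t \<otimes>\<^bsub>Q\<^esub> letter v b \<otimes>\<^bsub>Q\<^esub> inv\<^bsub>Q\<^esub> t) \<otimes>\<^bsub>Q\<^esub> inv\<^bsub>Q\<^esub> z"
  shows "\<exists>s\<in>parabolic (star u). \<exists>r\<in>parabolic (star v). t = s \<otimes>\<^bsub>Q\<^esub> r"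
proof -
  interpret Gu: group "G u" using uv(1) by (rule vertex_group)
  interpret Gv: group "G v" using uv(2) by (rule vertex_group)
  \<comment> \<open>\<open>T k\<close> says that \<open>k\<close> represents an element of the
    double coset of \<open>t\<close> between the parabolic subgroups of the two stars. The claim
    amounts to \<open>T []\<close>.\<close>
  define T where "T k \<longleftrightarrow> k \<in> W \<and> (\<exists>s\<in>parabolic (star u). \<exists>r\<in>parabolic (star v).
    t = s \<otimes>\<^bsub>Q\<^esub> pi k \<otimes>\<^bsub>Q\<^esub> r)" for k
  have one: "\<one>\<^bsub>Q\<^esub> \<in> parabolic S" for S using subgroup_parabolic by (rule subgroup.one_closed)
  obtain t0 where t0: "t0 \<in> W" "t = pi t0" using pi_surj[OF t] by blast
  then have "T t0" using one[of "star u"] one[of "star v"] by (force simp: T_def)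
  \<comment> \<open>Passing to the normal form makes a shortest word reduced without lengthening
    it.\<close>
  define k where "k = nf (arg_min length T)"
  have T_min: "T (arg_min length T)" "\<And>k'. T k' \<Longrightarrow> length (arg_min length T) \<le> length k'"
    using arg_min_nat_lemma[of T t0 length] \<open>T t0\<close> by auto
  then have Tk: "T k" by (simp add: k_def T_def pi_nf nf_words)
  have red: "reduced k" by (simp add: k_def reduced_nf)
  have "length (nf w) \<le> length w" for w
    using count_letters_le_length[of "\<lambda>_. True" w] by (simp add: count_letters_def)
  then have min: "\<And>k'. T k' \<Longrightarrow> length k \<le> length k'"
    using T_min(2) by (auto simp: k_def intro: order.trans)
  obtain s r where k: "k \<in> W" and s: "s \<in> parabolic (star u)" and r: "r \<in> parabolic (star v)"
    and t_eq: "t = s \<otimes>\<^bsub>Q\<^esub> pi k \<otimes>\<^bsub>Q\<^esub> r" using Tk by (auto simp: T_def)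
  note sr [simp] = parabolic_closed[OF s] parabolic_closed[OF r]
  have pull: "pi (m @ x # w) = letter (fst x) (snd x) \<otimes>\<^bsub>Q\<^esub> pi (m @ w)"
    if "m @ x # w \<in> W" "\<forall>y\<in>set m. adj (fst y) (fst x)" for m x w
    using that
  proof (induction m)
    case Nil
    then show ?case by (simp add: pi_Cons)
  next
    case (Cons y m)
    have "pi ((y # m) @ x # w) = letter (fst y) (snd y) \<otimes>\<^bsub>Q\<^esub> letter (fst x) (snd x) \<otimes>\<^bsub>Q\<^esub> pi (m @ w)"
      using Cons by (simp add: pi_Cons Q.m_assoc)
    also have "letter (fst y) (snd y) \<otimes>\<^bsub>Q\<^esub> letter (fst x) (snd x)
        = letter (fst x) (snd x) \<otimes>\<^bsub>Q\<^esub> letter (fst y) (snd y)"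
      using Cons.prems by (intro letter_commute) auto
    finally show ?case using Cons.prems by (simp add: pi_Cons Q.m_assoc)
  qed
  \<comment> \<open>A letter in the star of \<open>u\<close> that can be shuffled to the front of
    \<open>k\<close> could be absorbed into \<open>s\<close>, leaving a shorter word.
    \<open>no_tail\<close> is the mirror image with \<open>r\<close>.\<close>
  have no_head: "fst x \<notin> star u" if "k = m @ x # w" "\<forall>y\<in>set m. adj (fst y) (fst x)" for m x w
  proof
    assume star: "fst x \<in> star u"
    have W: "fst x \<in> V" "snd x \<in> carrier (G (fst x))" "m @ w \<in> W" using k that(1) by auto
    have "t = s \<otimes>\<^bsub>Q\<^esub> letter (fst x) (snd x) \<otimes>\<^bsub>Q\<^esub> pi (m @ w) \<otimes>\<^bsub>Q\<^esub> r"
      using t_eq pull[of m x w] k that W by (simp add: Q.m_assoc)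
    then have "T (m @ w)" unfolding T_def
      using W star r by (blast intro: parabolic_mult[OF s] letter_parabolic)
    then show False using min[of "m @ w"] that(1) by simp
  qed
  have no_tail: "fst x \<notin> star v" if "k = m @ x # w" "\<forall>y\<in>set w. adj (fst y) (fst x)" for m x w
  proof
    assume star: "fst x \<in> star v"
    have W: "fst x \<in> V" "snd x \<in> carrier (G (fst x))" "m \<in> W" "w \<in> W" "x # w \<in> W"
      using k that(1) by auto
    have "pi (x # w) = pi (w @ [x])"
      using pull[of w x "[]"] that W by (simp add: pi_Cons)
    then have "pi k = pi (m @ w) \<otimes>\<^bsub>Q\<^esub> letter (fst x) (snd x)"
      using W that(1) pi_append[of m "x # w"] by (simp add: pi_append pi_Cons pi_Nil Q.m_assoc)
    then have "t = s \<otimes>\<^bsub>Q\<^esub> pi (m @ w) \<otimes>\<^bsub>Q\<^esub> (letter (fst x) (snd x) \<otimes>\<^bsub>Q\<^esub> r)"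
      using t_eq W by (simp add: Q.m_assoc)
    then have "T (m @ w)" unfolding T_def
      using W star r s by (auto intro!: parabolic_mult letter_parabolic)
    then show False using min[of "m @ w"] that(1) by simp
  qed
  show ?thesis
  proof (cases "k = []")
    case True
    then show ?thesis using t_eq s r by (auto simp: pi_Nil)
  next
    case False
    \<comment> \<open>Conjugation by \<open>s\<close> and \<open>r\<close> stays inside the vertex
      groups at \<open>u\<close> and \<open>v\<close>, so these factors of \<open>t\<close> are
      absorbed into new non-trivial letters.\<close>
    obtain a' where a': "a' \<in> carrier (G u)" "conjugate_in (G u) a' a"
      "inv\<^bsub>Q\<^esub> s \<otimes>\<^bsub>Q\<^esub> letter u a \<otimes>\<^bsub>Q\<^esub> inv\<^bsub>Q\<^esub> (inv\<^bsub>Q\<^esub> s) = letter u a'"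
      using parabolic_star_conj_letter[OF uv(1) a(1) parabolic_inv[OF s]] by blast
    obtain b' where b': "b' \<in> carrier (G v)" "conjugate_in (G v) b' b"
      "r \<otimes>\<^bsub>Q\<^esub> letter v b \<otimes>\<^bsub>Q\<^esub> inv\<^bsub>Q\<^esub> r = letter v b'"
      using parabolic_star_conj_letter[OF uv(2) b(1) r] by blast
    have ne: "a' \<noteq> \<one>\<^bsub>G u\<^esub>" "b' \<noteq> \<one>\<^bsub>G v\<^esub>"
      using conjugate_in_one_iff[OF _ a(1) a'(2)] conjugate_in_one_iff[OF _ b(1) b'(2)] a b
        Gu.is_group Gv.is_group by auto
    define y where "y = (u, a') # k @ (v, b') # inv_word k"
    have y: "y \<in> W" using k a' b' uv by (simp add: y_def)
    have blocked: "front_val x (y' # w) = \<one>\<^bsub>G x\<^esub>" if "fst y' \<notin> star x" for x y' w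
      using that by (simp add: star_def)
    have star_sym: "x \<notin> star x' \<longleftrightarrow> x' \<notin> star x" for x x'
      by (auto simp: star_def adj_sym)
    obtain x0 k0 where hd: "k = x0 # k0" using False by (cases k) auto
    obtain x1 k1 where tl: "k = k1 @ [x1]" using False by (cases k rule: rev_cases) auto
    have hd': "fst x0 \<notin> star u" using no_head[of "[]" x0 k0] hd by simp
    have tl': "fst x1 \<notin> star v" using no_tail[of k1 x1 "[]"] tl by simp
    \<comment> \<open>The second conjunct carries the induction: a non-empty power begins with a
      letter at \<open>u\<close>, which blocks every letter outside the star of \<open>u\<close>.
      Letters that can be shuffled to the end of \<open>inv_word k\<close> are inverses of front
      letters of \<open>k\<close>, hence outside that star by \<open>no_head\<close>.\<close>
    have red_y: "reduced (concat (replicate n y)) \<and>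
        (\<forall>x. x \<notin> star u \<longrightarrow> front_val x (concat (replicate n y)) = \<one>\<^bsub>G x\<^esub>)" for n
    proof (induction n)
      case (Suc n)
      let ?z = "concat (replicate n y)"
      have "reduced (inv_word k @ ?z)"
      proof (rule reduced_append_right)
        show "reduced (inv_word k)" using k red by (rule reduced_inv_word)
        show "reduced ?z" using Suc by simp
        fix m x w assume m: "inv_word k = m @ x # w" "\<forall>y\<in>set w. adj (fst y) (fst x)"
        have "fst x \<notin> star u"
          using no_head[OF inv_word_eq_append[OF k m(1)]] m(2)
            labels_inv_word_iff[of w "\<lambda>i. adj i (fst x)"] by simp
        then show "front_val (fst x) ?z = \<one>\<^bsub>G (fst x)\<^esub>" using Suc by simp
      qed
      then have "reduced ((v, b') # inv_word k @ ?z)"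
        using ne blocked[of "(fst x1, inv\<^bsub>G (fst x1)\<^esub> snd x1)"] tl tl' by simp
      then have "reduced (k @ (v, b') # inv_word k @ ?z)"
        using no_tail star_sym by (intro reduced_append_right red blocked) auto
      then have "reduced ((u, a') # k @ (v, b') # inv_word k @ ?z)"
        using ne blocked[of x0] hd hd' by simp
      moreover have "front_val x ((u, a') # w) = \<one>\<^bsub>G x\<^esub>" if "x \<notin> star u" for x w
        using that star_sym by (intro blocked) auto
      ultimately show ?case by (simp add: y_def del: front_val.simps)
    qed simp
    obtain z' where z': "z' \<in> W" "z \<otimes>\<^bsub>Q\<^esub> s = pi z'"
      using pi_surj[of "z \<otimes>\<^bsub>Q\<^esub> s"] z by auto
    have "pi [c, d] = (z \<otimes>\<^bsub>Q\<^esub> s) \<otimes>\<^bsub>Q\<^esub> (letter u a' \<otimes>\<^bsub>Q\<^esub> pi k \<otimes>\<^bsub>Q\<^esub> letter v b' \<otimes>\<^bsub>Q\<^esub> inv\<^bsub>Q\<^esub> pi k)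
        \<otimes>\<^bsub>Q\<^esub> inv\<^bsub>Q\<^esub> (z \<otimes>\<^bsub>Q\<^esub> s)"
      unfolding eq t_eq a'(3)[symmetric] b'(3)[symmetric]
      using z k uv a b by (simp add: Q_simps)
    also have "\<dots> = pi (z' @ y @ inv_word z')"
      using z' k a' b' uv by (simp add: y_def Q_simps pi_Cons)
    finally have conj: "pi [c, d] = pi (z' @ y @ inv_word z')" .
    \<comment> \<open>One more than the length of the conjugator: the counts below give
      \<open>n * length k\<close> at most \<open>length z'\<close>, which is impossible for
      non-empty \<open>k\<close>.\<close>
    define n where "n = Suc (length z')"
    have "count_letters (\<lambda>_. True) (concat (replicate n y)) = n * (2 + 2 * length k)"
      using count_letters_reduced[of "concat (replicate n y)" "\<lambda>_. True"] red_y[of n] y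
      by (simp add: length_concat sum_list_replicate y_def)
    moreover have "count_letters (\<lambda>_. True) (concat (replicate n [c, d])) \<le> n * 2"
      using count_letters_le_length[of "\<lambda>_. True" "concat (replicate n [c, d])"]
      by (simp add: length_concat sum_list_replicate)
    ultimately have "n * (2 + 2 * length k) \<le> n * 2 + 2 * length z'"
      using count_letters_conj_powers[OF y cd z'(1) conj, of "\<lambda>_. True" n] by linarith
    then have "n * length k \<le> length z'" by (simp add: distrib_left)
    moreover have "n \<le> n * length k" using False by (cases k) auto
    ultimately have "n \<le> length z'" by linarith
    then show ?thesis by (simp add: n_def)
  qed
qed

text \<open>Letters at two distinct non-adjacent vertices never pass one another, so powers of their
  product are reduced as written. The \<open>n\<close>-th power of \<open>a b\<close> contains the
  letter \<open>a\<close> exactly \<open>n\<close> times, that of \<open>a' b'\<close> not at all if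
  \<open>a'\<close> differs from \<open>a\<close>, and conjugation changes this count by a bounded
  amount only.\<close>

lemma free_letters_rigid:
  assumes uv: "u \<in> V" "v \<in> V" "u \<noteq> v" "\<not> adj u v"
    and a: "a \<in> carrier (G u)" "a \<noteq> \<one>\<^bsub>G u\<^esub>" and b: "b \<in> carrier (G v)" "b \<noteq> \<one>\<^bsub>G v\<^esub>"
    and a': "a' \<in> carrier (G u)" "a' \<noteq> \<one>\<^bsub>G u\<^esub>" and b': "b' \<in> carrier (G v)" "b' \<noteq> \<one>\<^bsub>G v\<^esub>"
    and z: "z \<in> carrier Q"
    and eq: "letter u a' \<otimes>\<^bsub>Q\<^esub> letter v b' = z \<otimes>\<^bsub>Q\<^esub> (letter u a \<otimes>\<^bsub>Q\<^esub> letter v b) \<otimes>\<^bsub>Q\<^esub> inv\<^bsub>Q\<^esub> z"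
  shows "a' = a"
proof (rule ccontr)
  assume ne: "a' \<noteq> a"
  have "\<not> adj v u" using uv adj_sym by blast
  have red: "reduced (concat (replicate n [(u, g), (v, h)]))"
    if "g \<noteq> \<one>\<^bsub>G u\<^esub>" "h \<noteq> \<one>\<^bsub>G v\<^esub>" for g h n
  proof (induction n)
    case (Suc n)
    then show ?case using that uv \<open>\<not> adj v u\<close> by (cases n) auto
  qed simp
  let ?P = "\<lambda>x. x = (u, a)"
  have count: "count_letters ?P (concat (replicate n [(u, g), (v, h)])) = (if g = a then n else 0)"
    if "g \<noteq> \<one>\<^bsub>G u\<^esub>" "h \<noteq> \<one>\<^bsub>G v\<^esub>" "g \<in> carrier (G u)" "h \<in> carrier (G v)" for g h n
  proof -
    have "count_letters ?P (concat (replicate n [(u, g), (v, h)]))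
        = length (filter ?P (concat (replicate n [(u, g), (v, h)])))"
      using that uv by (intro count_letters_reduced red concat_replicate_words) auto
    also have "\<dots> = (if g = a then n else 0)" using uv(3) by (induction n) auto
    finally show ?thesis .
  qed
  obtain z' where z': "z' \<in> W" "z = pi z'" using pi_surj[OF z] by blast
  have "pi [(u, a'), (v, b')] = pi (z' @ [(u, a), (v, b)] @ inv_word z')"
    using eq z' uv a b a' b' by (simp add: Q_simps pi_Cons)
  then have "count_letters ?P (concat (replicate n [(u, a), (v, b)]))
      \<le> count_letters ?P (concat (replicate n [(u, a'), (v, b')])) + 2 * length z'" for n
    using uv a b a' b' z' by (intro count_letters_conj_powers) auto
  from this[of "Suc (2 * length z')"] show False
    using count[OF a(2) b(2) a(1) b(1), of "Suc (2 * length z')"]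
      count[OF a'(2) b'(2) a'(1) b'(1), of "Suc (2 * length z')"] ne
    by (simp del: replicate_Suc)
qed

text \<open>
  The witness is the inverse of the retraction \<open>\<rho>\<close> of \<open>t\<close> onto the parabolic of \<open>S\<close>: if
  \<open>c = t s\<close> lies in the parabolic of \<open>T\<close>, then so does \<open>\<rho> c\<close>, and \<open>t\<close> times the inverse of
  \<open>\<rho> t\<close> equals \<open>c\<close> times the inverse of \<open>\<rho> c\<close>.
\<close>

lemma parabolic_projection:
  assumes t: "t \<in> carrier Q"
  shows "\<exists>r\<in>parabolic S. \<forall>T. (\<exists>s\<in>parabolic S. t \<otimes>\<^bsub>Q\<^esub> s \<in> parabolic T) \<longrightarrow> t \<otimes>\<^bsub>Q\<^esub> r \<in> parabolic T"
proof -
  obtain w where w: "w \<in> W" "t = pi w" using pi_surj[OF t] by blast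
  let ?f = "filter (\<lambda>x. fst x \<in> S)"
  show ?thesis
  proof (intro bexI[of _ "inv\<^bsub>Q\<^esub> pi (?f w)"] allI impI)
    show "inv\<^bsub>Q\<^esub> pi (?f w) \<in> parabolic S"
      using w by (intro parabolic_inv parabolicI) auto
    fix T assume "\<exists>s\<in>parabolic S. t \<otimes>\<^bsub>Q\<^esub> s \<in> parabolic T"
    then obtain s where s: "s \<in> parabolic S" "t \<otimes>\<^bsub>Q\<^esub> s \<in> parabolic T" by blast
    obtain x where x: "x \<in> W" "fst ` set x \<subseteq> S" "s = pi x" using s(1) by (rule parabolicE)
    obtain y where y: "y \<in> W" "fst ` set y \<subseteq> T" "t \<otimes>\<^bsub>Q\<^esub> s = pi y" using s(2) by (rule parabolicE)
    have "?f x = x" using x(2) by (auto intro: filter_True)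
    then have fy: "pi (?f y) = pi (?f w) \<otimes>\<^bsub>Q\<^esub> pi x"
      using filter_labels_cong[of "w @ x" y S] w x y by (simp add: pi_append)
    have "inv\<^bsub>Q\<^esub> pi (?f w) = pi x \<otimes>\<^bsub>Q\<^esub> inv\<^bsub>Q\<^esub> pi (?f y)"
      unfolding fy using w x by (simp add: Q_simps)
    then have "t \<otimes>\<^bsub>Q\<^esub> inv\<^bsub>Q\<^esub> pi (?f w) = pi y \<otimes>\<^bsub>Q\<^esub> inv\<^bsub>Q\<^esub> pi (?f y)"
      using w x y by (simp add: Q.m_assoc[symmetric])
    moreover have "pi (?f y) \<in> parabolic T" using y by (intro parabolicI) auto
    moreover have "pi y \<in> parabolic T" using y by (intro parabolicI)
    ultimately show "t \<otimes>\<^bsub>Q\<^esub> inv\<^bsub>Q\<^esub> pi (?f w) \<in> parabolic T"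
      by (simp add: parabolic_mult parabolic_inv)
  qed
qed

subsection \<open>Pointwise inner automorphisms of graph products\<close>

text \<open>Let \<open>t\<close> be the product of the inverse of \<open>h\<close> with
  \<open>g\<close>. The image of \<open>a b\<close> is the conjugate by \<open>h\<close> of
  \<open>a t b\<close> times the inverse of \<open>t\<close>, and it is conjugate to
  \<open>a b\<close>, so \<open>star_double_coset\<close> applies. The vertices may coincide, which
  allows comparing conjugators within one vertex group.\<close>

lemma conjugators_meet:
  assumes hom: "\<phi> \<in> hom Q Q" and pw: "pointwise_inner Q \<phi>"
    and u: "u \<in> V" "a \<in> carrier (G u)" "a \<noteq> \<one>\<^bsub>G u\<^esub>"
    and v: "v \<in> V" "b \<in> carrier (G v)" "b \<noteq> \<one>\<^bsub>G v\<^esub>"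
    and h: "h \<in> carrier Q" "\<phi> (letter u a) = h \<otimes>\<^bsub>Q\<^esub> letter u a \<otimes>\<^bsub>Q\<^esub> inv\<^bsub>Q\<^esub> h"
    and g: "g \<in> carrier Q" "\<phi> (letter v b) = g \<otimes>\<^bsub>Q\<^esub> letter v b \<otimes>\<^bsub>Q\<^esub> inv\<^bsub>Q\<^esub> g"
  shows "\<exists>s\<in>parabolic (star u). \<exists>r\<in>parabolic (star v). inv\<^bsub>Q\<^esub> h \<otimes>\<^bsub>Q\<^esub> g = s \<otimes>\<^bsub>Q\<^esub> r"
proof -
  let ?ab = "letter u a \<otimes>\<^bsub>Q\<^esub> letter v b"
  have ab: "?ab \<in> carrier Q" using u v by simp
  obtain k where k: "k \<in> carrier Q" "\<phi> ?ab = k \<otimes>\<^bsub>Q\<^esub> ?ab \<otimes>\<^bsub>Q\<^esub> inv\<^bsub>Q\<^esub> k"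
    using pw ab by (rule pointwise_innerE)
  have \<phi>_ab: "\<phi> ?ab = h \<otimes>\<^bsub>Q\<^esub> letter u a \<otimes>\<^bsub>Q\<^esub> inv\<^bsub>Q\<^esub> h \<otimes>\<^bsub>Q\<^esub> (g \<otimes>\<^bsub>Q\<^esub> letter v b \<otimes>\<^bsub>Q\<^esub> inv\<^bsub>Q\<^esub> g)"
    using hom_mult[OF hom] u v h g by simp
  have "pi [(u, a), (v, b)] = ?ab" using u v by (simp add: pi_Cons pi_Nil)
  also have "\<dots> = inv\<^bsub>Q\<^esub> k \<otimes>\<^bsub>Q\<^esub> \<phi> ?ab \<otimes>\<^bsub>Q\<^esub> k"
    unfolding k(2) using u v k(1) by (simp add: Q_simps)
  also have "\<dots> = (inv\<^bsub>Q\<^esub> k \<otimes>\<^bsub>Q\<^esub> h) \<otimes>\<^bsub>Q\<^esub> (letter u a \<otimes>\<^bsub>Q\<^esub> (inv\<^bsub>Q\<^esub> h \<otimes>\<^bsub>Q\<^esub> g) \<otimes>\<^bsub>Q\<^esub> letter v b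
      \<otimes>\<^bsub>Q\<^esub> inv\<^bsub>Q\<^esub> (inv\<^bsub>Q\<^esub> h \<otimes>\<^bsub>Q\<^esub> g)) \<otimes>\<^bsub>Q\<^esub> inv\<^bsub>Q\<^esub> (inv\<^bsub>Q\<^esub> k \<otimes>\<^bsub>Q\<^esub> h)"
    unfolding \<phi>_ab using u v k(1) h(1) g(1) by (simp add: Q_simps)
  finally show ?thesis
    using u v k(1) h(1) g(1)
    by (intro star_double_coset[of u v a b "(u, a)" "(v, b)" _ "inv\<^bsub>Q\<^esub> k \<otimes>\<^bsub>Q\<^esub> h"]) auto
qed

text \<open>
  Helly property of parabolic cosets; it works because the point \<open>t r\<close> of
  \<open>parabolic_projection\<close> does not depend on \<open>T\<close>.
\<close>

lemma common_coset_point: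
  assumes "finite C"
    and hs: "\<And>v. v \<in> C \<Longrightarrow> hs v \<in> carrier Q"
    and meet: "\<And>u v. u \<in> C \<Longrightarrow> v \<in> C \<Longrightarrow>
      \<exists>s\<in>parabolic (S u). \<exists>r\<in>parabolic (S v). inv\<^bsub>Q\<^esub> hs u \<otimes>\<^bsub>Q\<^esub> hs v = s \<otimes>\<^bsub>Q\<^esub> r"
  shows "\<exists>h\<in>carrier Q. \<forall>v\<in>C. inv\<^bsub>Q\<^esub> h \<otimes>\<^bsub>Q\<^esub> hs v \<in> parabolic (S v)"
  using assms
proof (induction C)
  case (insert n C)
  then obtain h where h: "h \<in> carrier Q" "\<And>v. v \<in> C \<Longrightarrow> inv\<^bsub>Q\<^esub> h \<otimes>\<^bsub>Q\<^esub> hs v \<in> parabolic (S v)"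
    by (metis insert_iff)
  have n: "hs n \<in> carrier Q" using insert.prems by simp
  let ?t = "inv\<^bsub>Q\<^esub> h \<otimes>\<^bsub>Q\<^esub> hs n"
  obtain r where r: "r \<in> parabolic (S n)"
    "\<And>T s. s \<in> parabolic (S n) \<Longrightarrow> ?t \<otimes>\<^bsub>Q\<^esub> s \<in> parabolic T \<Longrightarrow> ?t \<otimes>\<^bsub>Q\<^esub> r \<in> parabolic T"
    using parabolic_projection[of ?t "S n"] h n by blast
  note rQ = parabolic_closed[OF r(1)]
  have "inv\<^bsub>Q\<^esub> (hs n \<otimes>\<^bsub>Q\<^esub> r) \<otimes>\<^bsub>Q\<^esub> hs v \<in> parabolic (S v)" if v: "v \<in> insert n C" for v
  proof (cases "v = n")
    case True
    then show ?thesis using rQ n r(1) by (simp add: Q_simps parabolic_inv)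
  next
    case False
    then have vC: "v \<in> C" using v by simp
    have hv: "hs v \<in> carrier Q" using insert.prems v by simp
    obtain s' r' where s': "s' \<in> parabolic (S v)" and r': "r' \<in> parabolic (S n)"
      and eq: "inv\<^bsub>Q\<^esub> hs v \<otimes>\<^bsub>Q\<^esub> hs n = s' \<otimes>\<^bsub>Q\<^esub> r'"
      using insert.prems(2)[of v n] v by auto
    note cl = parabolic_closed[OF s'] parabolic_closed[OF r']
    \<comment> \<open>The pairwise meeting of the cosets at \<open>v\<close> and \<open>n\<close>
      supplies the \<open>s\<close> that the choice of \<open>r\<close> asks for, namely the inverse
      of \<open>r'\<close>.\<close>
    have "?t \<otimes>\<^bsub>Q\<^esub> inv\<^bsub>Q\<^esub> r' = (inv\<^bsub>Q\<^esub> h \<otimes>\<^bsub>Q\<^esub> hs v) \<otimes>\<^bsub>Q\<^esub> (inv\<^bsub>Q\<^esub> hs v \<otimes>\<^bsub>Q\<^esub> hs n) \<otimes>\<^bsub>Q\<^esub> inv\<^bsub>Q\<^esub> r'"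
      using h(1) n hv cl by (simp add: Q_simps)
    also have "\<dots> = (inv\<^bsub>Q\<^esub> h \<otimes>\<^bsub>Q\<^esub> hs v) \<otimes>\<^bsub>Q\<^esub> s'"
      unfolding eq using h(1) hv cl by (simp add: Q_simps)
    also have "\<dots> \<in> parabolic (S v)" using h(2)[OF vC] s' by (rule parabolic_mult)
    finally have "?t \<otimes>\<^bsub>Q\<^esub> r \<in> parabolic (S v)" using r(2) r' parabolic_inv by blast
    then have "inv\<^bsub>Q\<^esub> (?t \<otimes>\<^bsub>Q\<^esub> r) \<otimes>\<^bsub>Q\<^esub> (inv\<^bsub>Q\<^esub> h \<otimes>\<^bsub>Q\<^esub> hs v) \<in> parabolic (S v)"
      using h(2)[OF vC] parabolic_mult parabolic_inv by blast
    then show ?thesis using h(1) n hv rQ by (simp add: Q_simps)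
  qed
  then show ?case using n rQ by (intro bexI[of _ "hs n \<otimes>\<^bsub>Q\<^esub> r"]) auto
qed auto

lemma pointwise_inner_conj_vertex:
  assumes hom: "\<phi> \<in> hom Q Q" and pw: "pointwise_inner Q \<phi>" and "finite V"
    and nontrivial: "\<And>v. v \<in> V \<Longrightarrow> \<exists>g\<in>carrier (G v). g \<noteq> \<one>\<^bsub>G v\<^esub>"
  shows "\<exists>h\<in>carrier Q. \<forall>v\<in>V. \<forall>b\<in>carrier (G v). \<exists>c\<in>carrier (G v).
    conjugate_in (G v) c b \<and> inv\<^bsub>Q\<^esub> h \<otimes>\<^bsub>Q\<^esub> \<phi> (letter v b) \<otimes>\<^bsub>Q\<^esub> h = letter v c"
proof -
  \<comment> \<open>One non-trivial element per vertex determines the cosets for the Helly property;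
    the other elements of the vertex group are compared with it afterwards.\<close>
  obtain x where x: "\<And>v. v \<in> V \<Longrightarrow> x v \<in> carrier (G v) \<and> x v \<noteq> \<one>\<^bsub>G v\<^esub>"
    using nontrivial by metis
  have "\<exists>h\<in>carrier Q. \<phi> (letter v (x v)) = h \<otimes>\<^bsub>Q\<^esub> letter v (x v) \<otimes>\<^bsub>Q\<^esub> inv\<^bsub>Q\<^esub> h" if "v \<in> V" for v
    using pw x[OF that] that by (auto simp: pointwise_inner_def conjugate_in_def)
  then obtain hs where hs: "\<And>v. v \<in> V \<Longrightarrow> hs v \<in> carrier Q"
    "\<And>v. v \<in> V \<Longrightarrow> \<phi> (letter v (x v)) = hs v \<otimes>\<^bsub>Q\<^esub> letter v (x v) \<otimes>\<^bsub>Q\<^esub> inv\<^bsub>Q\<^esub> hs v"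
    by metis
  obtain h where h: "h \<in> carrier Q" "\<And>v. v \<in> V \<Longrightarrow> inv\<^bsub>Q\<^esub> h \<otimes>\<^bsub>Q\<^esub> hs v \<in> parabolic (star v)"
    using common_coset_point[of V hs star] \<open>finite V\<close> hs conjugators_meet[OF hom pw] x
    by (metis (no_types, lifting))
  have "\<exists>c\<in>carrier (G v). conjugate_in (G v) c b
      \<and> inv\<^bsub>Q\<^esub> h \<otimes>\<^bsub>Q\<^esub> \<phi> (letter v b) \<otimes>\<^bsub>Q\<^esub> h = letter v c"
    if v: "v \<in> V" and b: "b \<in> carrier (G v)" for v b
  proof -
    obtain g where g: "g \<in> carrier Q" "\<phi> (letter v b) = g \<otimes>\<^bsub>Q\<^esub> letter v b \<otimes>\<^bsub>Q\<^esub> inv\<^bsub>Q\<^esub> g"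
      using pw v b by (auto elim!: pointwise_innerE[of Q \<phi> "letter v b"])
    show ?thesis
    proof (cases "b = \<one>\<^bsub>G v\<^esub>")
      case True
      interpret Gv: group "G v" using v by (rule vertex_group)
      have "conjugate_in (G v) \<one>\<^bsub>G v\<^esub> b"
        using True by (auto simp: conjugate_in_def intro!: bexI[of _ "\<one>\<^bsub>G v\<^esub>"])
      then show ?thesis using True v g h by (auto simp: letter_one intro!: bexI[of _ "\<one>\<^bsub>G v\<^esub>"])
    next
      case False
      \<comment> \<open>Here both vertices are \<open>v\<close>: the conjugators of \<open>b\<close>
        and of \<open>x v\<close> lie in the same left coset of the parabolic subgroup of the star,
        so \<open>h\<close> serves for \<open>b\<close> too.\<close>
      obtain s r where sr: "s \<in> parabolic (star v)" "r \<in> parabolic (star v)"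
        "inv\<^bsub>Q\<^esub> hs v \<otimes>\<^bsub>Q\<^esub> g = s \<otimes>\<^bsub>Q\<^esub> r"
        using conjugators_meet[OF hom pw v _ _ v b False hs(1)[OF v] hs(2)[OF v] g] x[OF v] by blast
      have "(inv\<^bsub>Q\<^esub> h \<otimes>\<^bsub>Q\<^esub> hs v) \<otimes>\<^bsub>Q\<^esub> (inv\<^bsub>Q\<^esub> hs v \<otimes>\<^bsub>Q\<^esub> g) \<in> parabolic (star v)"
        unfolding sr(3) by (intro parabolic_mult h v sr)
      then have "inv\<^bsub>Q\<^esub> h \<otimes>\<^bsub>Q\<^esub> g \<in> parabolic (star v)"
        using h(1) g(1) hs(1)[OF v] by (simp add: Q_simps)
      from parabolic_star_conj_letter[OF v b this] obtain c where
        "c \<in> carrier (G v)" "conjugate_in (G v) c b"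
        "inv\<^bsub>Q\<^esub> h \<otimes>\<^bsub>Q\<^esub> g \<otimes>\<^bsub>Q\<^esub> letter v b \<otimes>\<^bsub>Q\<^esub> inv\<^bsub>Q\<^esub> (inv\<^bsub>Q\<^esub> h \<otimes>\<^bsub>Q\<^esub> g) = letter v c"
        by blast
      moreover have "inv\<^bsub>Q\<^esub> h \<otimes>\<^bsub>Q\<^esub> g \<otimes>\<^bsub>Q\<^esub> letter v b \<otimes>\<^bsub>Q\<^esub> inv\<^bsub>Q\<^esub> (inv\<^bsub>Q\<^esub> h \<otimes>\<^bsub>Q\<^esub> g)
          = inv\<^bsub>Q\<^esub> h \<otimes>\<^bsub>Q\<^esub> \<phi> (letter v b) \<otimes>\<^bsub>Q\<^esub> h"
        unfolding g(2) using h(1) g(1) v b by (simp add: Q_simps)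
      ultimately show ?thesis by auto
    qed
  qed
  then show ?thesis using h(1) by blast
qed

section \<open>Central vertex groups as direct factors, and the two implications\<close>

lemma central_adj: "central_vertex V E v \<Longrightarrow> u \<in> V \<Longrightarrow> u \<noteq> v \<Longrightarrow> adj u v"
  by (simp add: central_vertex_def adj_def)

text \<open>The letters at a central vertex commute with all others and can be collected at the end,
  where they multiply to \<open>eval v w\<close>. The remaining factor is the retraction that
  deletes them; the label set is a complement in order to match
  \<open>filter_labels_cong\<close>.\<close>

lemma pi_split_central:
  assumes v: "central_vertex V E v" and w: "w \<in> W"
  shows "pi w = pi (filter (\<lambda>x. fst x \<in> - {v}) w) \<otimes>\<^bsub>Q\<^esub> letter v (eval v w)"
    and "g \<in> carrier (G v) \<Longrightarrow> letter v g \<otimes>\<^bsub>Q\<^esub> pi (filter (\<lambda>x. fst x \<in> - {v}) w)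
      = pi (filter (\<lambda>x. fst x \<in> - {v}) w) \<otimes>\<^bsub>Q\<^esub> letter v g"
proof -
  let ?f = "filter (\<lambda>x. fst x \<in> - {v})"
  have vV: "v \<in> V" using v by (simp add: central_vertex_def)
  have comm: "letter v g \<otimes>\<^bsub>Q\<^esub> pi (?f w) = pi (?f w) \<otimes>\<^bsub>Q\<^esub> letter v g"
    if "g \<in> carrier (G v)" "w \<in> W" for g w
    using that(2)
  proof (induction w)
    case Nil
    then show ?case using vV that by (simp add: pi_Nil)
  next
    case (Cons x w)
    show ?case
    proof (cases "fst x = v")
      case False
      then have x: "adj (fst x) v" "x # ?f w \<in> W" using Cons.prems central_adj[OF v] by auto
      have "letter v g \<otimes>\<^bsub>Q\<^esub> pi (x # ?f w)
          = letter v g \<otimes>\<^bsub>Q\<^esub> letter (fst x) (snd x) \<otimes>\<^bsub>Q\<^esub> pi (?f w)"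
        using x vV that by (simp add: pi_Cons Q.m_assoc)
      also have "letter v g \<otimes>\<^bsub>Q\<^esub> letter (fst x) (snd x) = letter (fst x) (snd x) \<otimes>\<^bsub>Q\<^esub> letter v g"
        using letter_commute[OF adj_sym[OF x(1)]] x that by simp
      finally show ?thesis using False Cons x vV that by (simp add: pi_Cons Q.m_assoc)
    qed (use Cons in auto)
  qed
  then show "g \<in> carrier (G v) \<Longrightarrow> letter v g \<otimes>\<^bsub>Q\<^esub> pi (?f w) = pi (?f w) \<otimes>\<^bsub>Q\<^esub> letter v g"
    using w by blast
  show "pi w = pi (?f w) \<otimes>\<^bsub>Q\<^esub> letter v (eval v w)"
    using w
  proof (induction w)
    case Nil
    then show ?case using vV by (simp add: pi_Nil letter_one)
  next
    case (Cons x w)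
    show ?case
    proof (cases "fst x = v")
      case True
      then have "snd x \<in> carrier (G v)" "w \<in> W" using Cons.prems by auto
      then show ?thesis using True Cons vV comm[of "snd x" w]
        by (simp add: pi_Cons letter_mult Q.m_assoc[symmetric])
    next
      case False
      then show ?thesis using Cons vV by (simp add: pi_Cons Q.m_assoc)
    qed
  qed
qed

text \<open>Extend the automorphism of the direct factor by the identity on the complement. The
  extension is pointwise inner because a conjugator for the component at \<open>v\<close> commutes
  with the complement, and \<open>eval\<close> maps a conjugator for the extension to one for the
  given automorphism.\<close>

lemma property_A_central_vertex:
  assumes A: "grossman_property_A Q" and v: "central_vertex V E v"
  shows "grossman_property_A (G v)"
  unfolding grossman_property_A_def
proof (intro ballI impI)
  fix \<alpha> assume iso: "\<alpha> \<in> iso (G v) (G v)" and pw: "pointwise_inner (G v) \<alpha>"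
  have vV: "v \<in> V" using v by (simp add: central_vertex_def)
  interpret Gv: group "G v" using vV by (rule vertex_group)
  have \<alpha>_hom: "\<alpha> \<in> hom (G v) (G v)" and \<alpha>_bij: "bij_betw \<alpha> (carrier (G v)) (carrier (G v))"
    using iso by (auto simp: iso_def)
  have \<alpha>_cl [simp]: "\<And>g. g \<in> carrier (G v) \<Longrightarrow> \<alpha> g \<in> carrier (G v)"
    using \<alpha>_hom by (rule hom_in_carrier)
  have \<alpha>_one: "\<alpha> \<one>\<^bsub>G v\<^esub> = \<one>\<^bsub>G v\<^esub>"
    using \<alpha>_hom Gv.is_group Gv.is_group by (rule hom_one)
  define f where "f = map (\<lambda>x. if fst x = v then (v, \<alpha> (snd x)) else x)"
  have f_words [simp]: "f w \<in> W" if "w \<in> W" for w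
    using that by (induction w) (auto simp: f_def vV)
  have f_append: "f (w @ z) = f w @ f z" for w z by (simp add: f_def)
  have f_filter: "filter (\<lambda>x. fst x \<in> - {v}) (f w) = filter (\<lambda>x. fst x \<in> - {v}) w" for w
    by (induction w) (auto simp: f_def)
  have f_eval: "eval v (f w) = \<alpha> (eval v w)" if "w \<in> W" for w
    using that
  proof (induction w)
    case (Cons x w)
    then show ?case using vV hom_mult[OF \<alpha>_hom, of "snd x" "eval v w"] by (auto simp: f_def)
  qed (simp add: f_def \<alpha>_one)
  \<comment> \<open>The right-hand side involves only two retractions of \<open>w\<close>, hence
    only \<open>pi w\<close>. This makes \<open>\<phi>\<close> independent of the word chosen by
    \<open>SOME\<close>.\<close>
  have f_pi: "pi (f w) = pi (filter (\<lambda>x. fst x \<in> - {v}) w) \<otimes>\<^bsub>Q\<^esub> letter v (\<alpha> (eval v w))"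
    if "w \<in> W" for w
    using pi_split_central(1)[OF v, of "f w"] that unfolding f_filter by (simp add: f_eval)
  define \<phi> where "\<phi> q = pi (f (SOME w. w \<in> W \<and> pi w = q))" for q
  have \<phi>_pi: "\<phi> (pi w) = pi (f w)" if "w \<in> W" for w
  proof -
    define w' where "w' = (SOME w'. w' \<in> W \<and> pi w' = pi w)"
    have w': "w' \<in> W" "pi w' = pi w"
      using someI[of "\<lambda>w'. w' \<in> W \<and> pi w' = pi w" w] that by (auto simp: w'_def)
    have "\<phi> (pi w) = pi (f w')" by (simp add: \<phi>_def w'_def)
    also have "\<dots> = pi (f w)"
      unfolding f_pi[OF w'(1)] f_pi[OF that] eval_cong[OF vV w'(2,1) that]
        filter_labels_cong[OF w'(2,1) that] ..
    finally show ?thesis .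
  qed
  have \<phi>_pw: "pointwise_inner Q \<phi>"
    unfolding pointwise_inner_def conjugate_in_def
  proof
    fix q assume "q \<in> carrier Q"
    then obtain w where w: "w \<in> W" "q = pi w" using pi_surj by blast
    let ?e = "eval v w" and ?p = "pi (filter (\<lambda>x. fst x \<in> - {v}) w)"
    have e: "?e \<in> carrier (G v)" using vV w by simp
    obtain c where c: "c \<in> carrier (G v)" "\<alpha> ?e = c \<otimes>\<^bsub>G v\<^esub> ?e \<otimes>\<^bsub>G v\<^esub> inv\<^bsub>G v\<^esub> c"
      using pw e by (rule pointwise_innerE)
    have "\<phi> q = ?p \<otimes>\<^bsub>Q\<^esub> letter v c \<otimes>\<^bsub>Q\<^esub> letter v ?e \<otimes>\<^bsub>Q\<^esub> inv\<^bsub>Q\<^esub> letter v c"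
      using w c e vV by (simp add: \<phi>_pi f_pi letter_mult letter_inv Q.m_assoc)
    also have "?p \<otimes>\<^bsub>Q\<^esub> letter v c = letter v c \<otimes>\<^bsub>Q\<^esub> ?p"
      using pi_split_central(2)[OF v w(1) c(1)] by simp
    also have "letter v c \<otimes>\<^bsub>Q\<^esub> ?p \<otimes>\<^bsub>Q\<^esub> letter v ?e \<otimes>\<^bsub>Q\<^esub> inv\<^bsub>Q\<^esub> letter v c
        = letter v c \<otimes>\<^bsub>Q\<^esub> q \<otimes>\<^bsub>Q\<^esub> inv\<^bsub>Q\<^esub> letter v c"
      using pi_split_central(1)[OF v w(1)] w c e vV by (simp add: Q.m_assoc)
    finally show "\<exists>h\<in>carrier Q. \<phi> q = h \<otimes>\<^bsub>Q\<^esub> q \<otimes>\<^bsub>Q\<^esub> inv\<^bsub>Q\<^esub> h"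
      using vV c by auto
  qed
  have \<phi>_hom: "\<phi> \<in> hom Q Q"
  proof (rule homI)
    fix q assume "q \<in> carrier Q"
    then show "\<phi> q \<in> carrier Q" using pi_surj \<phi>_pi by fastforce
  next
    fix q q' assume "q \<in> carrier Q" "q' \<in> carrier Q"
    then obtain w w' where "w \<in> W" "q = pi w" "w' \<in> W" "q' = pi w'" using pi_surj by metis
    then show "\<phi> (q \<otimes>\<^bsub>Q\<^esub> q') = \<phi> q \<otimes>\<^bsub>Q\<^esub> \<phi> q'"
      using \<phi>_pi[of "w @ w'"] by (simp add: \<phi>_pi pi_append f_append)
  qed
  have "inj_on \<phi> (carrier Q)"
    using Q.is_group \<phi>_hom \<phi>_pw by (rule pointwise_inner_inj_on)
  moreover have "\<phi> ` carrier Q = carrier Q"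
  proof
    show "carrier Q \<subseteq> \<phi> ` carrier Q"
    proof
      fix q assume "q \<in> carrier Q"
      then obtain w where w: "w \<in> W" "q = pi w" using pi_surj by blast
      have "\<exists>z\<in>W. f z = w" using w(1)
      proof (induction w)
        case (Cons x w)
        then obtain z where z: "z \<in> W" "f z = w" by auto
        show ?case
        proof (cases "fst x = v")
          case True
          then have "snd x \<in> \<alpha> ` carrier (G v)"
            using Cons.prems \<alpha>_bij by (auto simp: bij_betw_def)
          then obtain g where g: "g \<in> carrier (G v)" "snd x = \<alpha> g" by blast
          then have "f ((v, g) # z) = x # w" using z True by (cases x) (auto simp: f_def)
          then show ?thesis using z g vV by (intro bexI[of _ "(v, g) # z"]) auto
        next
          case False
          then have "f (x # z) = x # w" using z by (auto simp: f_def)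
          then show ?thesis using z Cons.prems by (intro bexI[of _ "x # z"]) auto
        qed
      qed (auto simp: f_def)
      then show "q \<in> \<phi> ` carrier Q" using w \<phi>_pi by (metis image_eqI pi_closed)
    qed
  qed (use \<phi>_hom in \<open>auto intro: hom_in_carrier\<close>)
  ultimately have "bij_betw \<phi> (carrier Q) (carrier Q)" by (rule bij_betw_imageI)
  then have "\<phi> \<in> iso Q Q" using \<phi>_hom by (rule isoI[rotated])
  then have "inner_automorphism Q \<phi>" using A \<phi>_pw unfolding grossman_property_A_def by blast
  then obtain h where h: "h \<in> carrier Q" "\<And>q. q \<in> carrier Q \<Longrightarrow> \<phi> q = h \<otimes>\<^bsub>Q\<^esub> q \<otimes>\<^bsub>Q\<^esub> inv\<^bsub>Q\<^esub> h"
    unfolding inner_automorphism_def by blast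
  obtain z where z: "z \<in> W" "h = pi z" using pi_surj[OF h(1)] by blast
  have "\<alpha> g = eval v z \<otimes>\<^bsub>G v\<^esub> g \<otimes>\<^bsub>G v\<^esub> inv\<^bsub>G v\<^esub> eval v z" if g: "g \<in> carrier (G v)" for g
  proof -
    have "pi (f [(v, g)]) = pi (z @ [(v, g)] @ inv_word z)"
      using h(2)[of "pi [(v, g)]"] \<phi>_pi[of "[(v, g)]"] g vV z by (simp add: Q_simps pi_Cons)
    then have "eval v (f [(v, g)]) = eval v (z @ [(v, g)] @ inv_word z)"
      using vV g z by (intro eval_cong) auto
    then show ?thesis using vV g z by (simp add: f_def eval_append eval_inv_word Gv.m_assoc)
  qed
  then show "inner_automorphism (G v) \<alpha>"
    unfolding inner_automorphism_def using vV z by (intro bexI[of _ "eval v z"]) auto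
qed

lemma property_A_graph_product:
  assumes "finite V"
    and nontrivial: "\<And>v. v \<in> V \<Longrightarrow> \<exists>g\<in>carrier (G v). g \<noteq> \<one>\<^bsub>G v\<^esub>"
    and A: "\<And>v. central_vertex V E v \<Longrightarrow> grossman_property_A (G v)"
  shows "grossman_property_A Q"
  unfolding grossman_property_A_def
proof (intro ballI impI)
  fix \<phi> assume iso: "\<phi> \<in> iso Q Q" and pw: "pointwise_inner Q \<phi>"
  have hom: "\<phi> \<in> hom Q Q" and surj: "\<phi> ` carrier Q = carrier Q"
    using iso by (auto simp: iso_def bij_betw_def)
  note \<phi>_cl [simp] = hom_in_carrier[OF hom]
  obtain h where h: "h \<in> carrier Q" and vertex: "\<forall>v\<in>V. \<forall>b\<in>carrier (G v). \<exists>c\<in>carrier (G v).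
    conjugate_in (G v) c b \<and> inv\<^bsub>Q\<^esub> h \<otimes>\<^bsub>Q\<^esub> \<phi> (letter v b) \<otimes>\<^bsub>Q\<^esub> h = letter v c"
    using pointwise_inner_conj_vertex[OF hom pw \<open>finite V\<close> nontrivial] by blast
  \<comment> \<open>With the common conjugator \<open>h\<close> removed, the map sends each vertex
    group into itself; \<open>\<alpha> v\<close> below describes it there.\<close>
  define \<psi> where "\<psi> q = inv\<^bsub>Q\<^esub> h \<otimes>\<^bsub>Q\<^esub> \<phi> q \<otimes>\<^bsub>Q\<^esub> h" for q
  have \<psi>_cl [simp]: "\<And>q. q \<in> carrier Q \<Longrightarrow> \<psi> q \<in> carrier Q" using h by (simp add: \<psi>_def)
  have \<psi>_mult: "\<psi> (q \<otimes>\<^bsub>Q\<^esub> q') = \<psi> q \<otimes>\<^bsub>Q\<^esub> \<psi> q'" if "q \<in> carrier Q" "q' \<in> carrier Q" for q q'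
    using that h hom_mult[OF hom that] by (simp add: \<psi>_def Q_simps)
  have \<psi>_conj: "\<exists>k\<in>carrier Q. \<psi> q = k \<otimes>\<^bsub>Q\<^esub> q \<otimes>\<^bsub>Q\<^esub> inv\<^bsub>Q\<^esub> k" if q: "q \<in> carrier Q" for q
  proof -
    obtain k where k: "k \<in> carrier Q" "\<phi> q = k \<otimes>\<^bsub>Q\<^esub> q \<otimes>\<^bsub>Q\<^esub> inv\<^bsub>Q\<^esub> k"
      using pw q by (rule pointwise_innerE)
    show ?thesis
      unfolding \<psi>_def k(2) using k(1) h q
      by (intro bexI[of _ "inv\<^bsub>Q\<^esub> h \<otimes>\<^bsub>Q\<^esub> k"]) (auto simp: Q_simps)
  qed
  obtain \<alpha> where \<alpha>: "\<And>v b. v \<in> V \<Longrightarrow> b \<in> carrier (G v) \<Longrightarrow> \<alpha> v b \<in> carrier (G v)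
      \<and> conjugate_in (G v) (\<alpha> v b) b \<and> \<psi> (letter v b) = letter v (\<alpha> v b)"
    using vertex unfolding \<psi>_def by metis
  have \<alpha>_one_iff: "\<alpha> v b = \<one>\<^bsub>G v\<^esub> \<longleftrightarrow> b = \<one>\<^bsub>G v\<^esub>" if "v \<in> V" "b \<in> carrier (G v)" for v b
    using conjugate_in_one_iff[OF vertex_group] \<alpha> that by blast
  have noncentral: "\<alpha> v b = b" if v: "v \<in> V" "\<not> central_vertex V E v" and b: "b \<in> carrier (G v)" for v b
  proof (cases "b = \<one>\<^bsub>G v\<^esub>")
    case True
    then show ?thesis using \<alpha>_one_iff v b by blast
  next
    case False
    \<comment> \<open>Non-centrality provides a vertex that is not adjacent to \<open>v\<close>. The
      letter at \<open>v\<close> comes first in the product because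
      \<open>free_letters_rigid\<close> fixes the first letter.\<close>
    obtain u where u: "u \<in> V" "u \<noteq> v" "\<not> adj v u"
      using v by (auto simp: central_vertex_def adj_def insert_commute)
    obtain a where a: "a \<in> carrier (G u)" "a \<noteq> \<one>\<^bsub>G u\<^esub>" using nontrivial[OF u(1)] by blast
    obtain k where k: "k \<in> carrier Q" "\<psi> (letter v b \<otimes>\<^bsub>Q\<^esub> letter u a)
        = k \<otimes>\<^bsub>Q\<^esub> (letter v b \<otimes>\<^bsub>Q\<^esub> letter u a) \<otimes>\<^bsub>Q\<^esub> inv\<^bsub>Q\<^esub> k"
      using \<psi>_conj u v a b by (metis Q.m_closed letter_closed)
    have "letter v (\<alpha> v b) \<otimes>\<^bsub>Q\<^esub> letter u (\<alpha> u a)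
        = k \<otimes>\<^bsub>Q\<^esub> (letter v b \<otimes>\<^bsub>Q\<^esub> letter u a) \<otimes>\<^bsub>Q\<^esub> inv\<^bsub>Q\<^esub> k"
      using k(2) \<psi>_mult[of "letter v b" "letter u a"] \<alpha> u v a b by simp
    then show ?thesis
      using free_letters_rigid[of v u b a "\<alpha> v b" "\<alpha> u a" k] u v a b k(1) False \<alpha> \<alpha>_one_iff by blast
  qed
  have central: "\<exists>s\<in>carrier (G v). \<forall>b\<in>carrier (G v). \<alpha> v b = s \<otimes>\<^bsub>G v\<^esub> b \<otimes>\<^bsub>G v\<^esub> inv\<^bsub>G v\<^esub> s"
    if cv: "central_vertex V E v" for v
  proof -
    have v: "v \<in> V" using cv by (simp add: central_vertex_def)
    interpret Gv: group "G v" using v by (rule vertex_group)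
    have \<alpha>_hom: "\<alpha> v \<in> hom (G v) (G v)"
    proof (rule homI)
      show "\<alpha> v b \<in> carrier (G v)" if "b \<in> carrier (G v)" for b using \<alpha> v that by blast
      fix b c assume bc: "b \<in> carrier (G v)" "c \<in> carrier (G v)"
      have "letter v (\<alpha> v (b \<otimes>\<^bsub>G v\<^esub> c)) = \<psi> (letter v b \<otimes>\<^bsub>Q\<^esub> letter v c)"
        using \<alpha>[OF v, of "b \<otimes>\<^bsub>G v\<^esub> c"] bc v by (simp add: letter_mult)
      also have "\<dots> = letter v (\<alpha> v b \<otimes>\<^bsub>G v\<^esub> \<alpha> v c)"
        using bc v \<alpha>[OF v bc(1)] \<alpha>[OF v bc(2)] by (simp add: \<psi>_mult letter_mult)
      finally show "\<alpha> v (b \<otimes>\<^bsub>G v\<^esub> c) = \<alpha> v b \<otimes>\<^bsub>G v\<^esub> \<alpha> v c"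
        using \<alpha> v bc by (intro letter_inject[OF v]) auto
    qed
    interpret \<alpha>: group_hom "G v" "G v" "\<alpha> v"
      by (intro group_hom.intro group_hom_axioms.intro \<alpha>_hom) (rule Gv.is_group)+
    have \<alpha>_pw: "pointwise_inner (G v) (\<alpha> v)" using \<alpha> v by (simp add: pointwise_inner_def)
    have "inj_on (\<alpha> v) (carrier (G v))"
      using Gv.is_group \<alpha>_hom \<alpha>_pw by (rule pointwise_inner_inj_on)
    \<comment> \<open>A preimage \<open>q\<close> of \<open>letter v y\<close> under
      \<open>\<psi>\<close> need not be visibly in the vertex group, so its retraction
      \<open>x\<close> is used instead. The product of \<open>q\<close> with the inverse of
      \<open>x\<close> retracts to the identity, and so does its image, a conjugate of it; that
      image is the letter of \<open>y\<close> times the inverse of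
      \<open>\<alpha> v x\<close>.\<close>
    moreover have "carrier (G v) \<subseteq> \<alpha> v ` carrier (G v)"
    proof
      fix y assume y: "y \<in> carrier (G v)"
      have "h \<otimes>\<^bsub>Q\<^esub> letter v y \<otimes>\<^bsub>Q\<^esub> inv\<^bsub>Q\<^esub> h \<in> \<phi> ` carrier Q" using surj h v y by simp
      then obtain q where q: "q \<in> carrier Q" "\<phi> q = h \<otimes>\<^bsub>Q\<^esub> letter v y \<otimes>\<^bsub>Q\<^esub> inv\<^bsub>Q\<^esub> h" by auto
      then have \<psi>q: "\<psi> q = letter v y" using h v y by (simp add: \<psi>_def Q_simps)
      obtain w where w: "w \<in> W" "q = pi w" using pi_surj[OF q(1)] by blast
      define x where "x = eval v w"
      have x: "x \<in> carrier (G v)" using v w by (simp add: x_def)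
      let ?x = "w @ [(v, inv\<^bsub>G v\<^esub> x)]"
      have xW: "?x \<in> W" using v w x by simp
      obtain k where k: "k \<in> carrier Q" "\<psi> (pi ?x) = k \<otimes>\<^bsub>Q\<^esub> pi ?x \<otimes>\<^bsub>Q\<^esub> inv\<^bsub>Q\<^esub> k"
        using \<psi>_conj xW pi_closed by blast
      obtain z where z: "z \<in> W" "k = pi z" using pi_surj[OF k(1)] by blast
      have "pi ?x = q \<otimes>\<^bsub>Q\<^esub> letter v (inv\<^bsub>G v\<^esub> x)"
        using w v x by (simp add: pi_append letter_def)
      then have "\<psi> (pi ?x) = letter v (y \<otimes>\<^bsub>G v\<^esub> \<alpha> v (inv\<^bsub>G v\<^esub> x))"
        using q v x y \<psi>q \<alpha>[of v "inv\<^bsub>G v\<^esub> x"] by (simp add: \<psi>_mult letter_mult)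
      then have "pi [(v, y \<otimes>\<^bsub>G v\<^esub> inv\<^bsub>G v\<^esub> \<alpha> v x)] = pi (z @ ?x @ inv_word z)"
        using k z xW x v w y by (simp add: Q_simps pi_Cons)
      then have "eval v [(v, y \<otimes>\<^bsub>G v\<^esub> inv\<^bsub>G v\<^esub> \<alpha> v x)] = eval v (z @ ?x @ inv_word z)"
        using v x y z w by (intro eval_cong) auto
      then have "y \<otimes>\<^bsub>G v\<^esub> inv\<^bsub>G v\<^esub> \<alpha> v x = \<one>\<^bsub>G v\<^esub>"
        using v x y z w by (simp add: eval_append eval_inv_word x_def[symmetric] Gv.m_assoc[symmetric])
      then have "y = \<alpha> v x" using x y \<alpha>.hom_closed Gv.inv_solve_right'[of "\<one>\<^bsub>G v\<^esub>" y "\<alpha> v x"] by simp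
      then show "y \<in> \<alpha> v ` carrier (G v)" using x by blast
    qed
    moreover have "\<alpha> v ` carrier (G v) \<subseteq> carrier (G v)" using \<alpha> v by blast
    ultimately have "bij_betw (\<alpha> v) (carrier (G v)) (carrier (G v))"
      by (intro bij_betw_imageI equalityI)
    then have "\<alpha> v \<in> iso (G v) (G v)" using \<alpha>_hom by (rule isoI[rotated])
    then have "inner_automorphism (G v) (\<alpha> v)"
      using A[OF cv] \<alpha>_pw unfolding grossman_property_A_def by blast
    then show ?thesis unfolding inner_automorphism_def .
  qed
  \<comment> \<open>The element \<open>s\<close> collects one conjugating letter per central vertex
    in \<open>C\<close>. Such a letter commutes with all other vertex groups, so it leaves the
    vertices treated before undisturbed; the second conjunct ensures that the old \<open>s\<close>
    does not disturb the new vertex either.\<close>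
  have "\<exists>s\<in>carrier Q. (\<forall>v\<in>C. \<forall>b\<in>carrier (G v). \<psi> (letter v b) = s \<otimes>\<^bsub>Q\<^esub> letter v b \<otimes>\<^bsub>Q\<^esub> inv\<^bsub>Q\<^esub> s)
      \<and> (\<forall>v\<in>V - C. \<forall>b\<in>carrier (G v). s \<otimes>\<^bsub>Q\<^esub> letter v b \<otimes>\<^bsub>Q\<^esub> inv\<^bsub>Q\<^esub> s = letter v b)"
    if "finite C" "C \<subseteq> {v. central_vertex V E v}" for C
    using that
  proof (induction C)
    case empty
    show ?case by (intro bexI[of _ "\<one>\<^bsub>Q\<^esub>"]) auto
  next
    case (insert c C)
    then obtain s where s: "s \<in> carrier Q"
      "\<And>v b. v \<in> C \<Longrightarrow> b \<in> carrier (G v) \<Longrightarrow> \<psi> (letter v b) = s \<otimes>\<^bsub>Q\<^esub> letter v b \<otimes>\<^bsub>Q\<^esub> inv\<^bsub>Q\<^esub> s"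
      "\<And>v b. v \<in> V - C \<Longrightarrow> b \<in> carrier (G v) \<Longrightarrow> s \<otimes>\<^bsub>Q\<^esub> letter v b \<otimes>\<^bsub>Q\<^esub> inv\<^bsub>Q\<^esub> s = letter v b"
      by auto
    have c: "central_vertex V E c" "c \<in> V" using insert.prems by (auto simp: central_vertex_def)
    obtain k where k: "k \<in> carrier (G c)"
      "\<And>b. b \<in> carrier (G c) \<Longrightarrow> \<alpha> c b = k \<otimes>\<^bsub>G c\<^esub> b \<otimes>\<^bsub>G c\<^esub> inv\<^bsub>G c\<^esub> k"
      using central[OF c(1)] by blast
    have other: "letter c k \<otimes>\<^bsub>Q\<^esub> letter v b \<otimes>\<^bsub>Q\<^esub> inv\<^bsub>Q\<^esub> letter c k = letter v b"
      if "v \<in> V" "v \<noteq> c" "b \<in> carrier (G v)" for v b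
      using letter_commute[OF adj_sym[OF central_adj[OF c(1) that(1,2)]] k(1) that(3)] that c k
      by (simp add: Q.m_assoc)
    have assoc: "s \<otimes>\<^bsub>Q\<^esub> letter c k \<otimes>\<^bsub>Q\<^esub> q \<otimes>\<^bsub>Q\<^esub> inv\<^bsub>Q\<^esub> (s \<otimes>\<^bsub>Q\<^esub> letter c k)
        = s \<otimes>\<^bsub>Q\<^esub> (letter c k \<otimes>\<^bsub>Q\<^esub> q \<otimes>\<^bsub>Q\<^esub> inv\<^bsub>Q\<^esub> letter c k) \<otimes>\<^bsub>Q\<^esub> inv\<^bsub>Q\<^esub> s" if "q \<in> carrier Q" for q
      using that s(1) c k(1) by (simp add: Q_simps)
    have CV: "C \<subseteq> V" using insert.prems by (auto simp: central_vertex_def)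
    have self: "s \<otimes>\<^bsub>Q\<^esub> (letter c k \<otimes>\<^bsub>Q\<^esub> letter c b \<otimes>\<^bsub>Q\<^esub> inv\<^bsub>Q\<^esub> letter c k) \<otimes>\<^bsub>Q\<^esub> inv\<^bsub>Q\<^esub> s
        = \<psi> (letter c b)" if b: "b \<in> carrier (G c)" for b
    proof -
      have "letter c k \<otimes>\<^bsub>Q\<^esub> letter c b \<otimes>\<^bsub>Q\<^esub> inv\<^bsub>Q\<^esub> letter c k = letter c (\<alpha> c b)"
        using b c k by (simp add: letter_mult letter_inv)
      then show ?thesis using s(3)[of c "\<alpha> c b"] \<alpha>[OF c(2) b] c insert.hyps by simp
    qed
    show ?case
    proof (intro bexI[of _ "s \<otimes>\<^bsub>Q\<^esub> letter c k"] conjI ballI)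
      fix v b assume v: "v \<in> insert c C" "b \<in> carrier (G v)"
      then have vV: "v \<in> V" using c CV by auto
      show "\<psi> (letter v b) = s \<otimes>\<^bsub>Q\<^esub> letter c k \<otimes>\<^bsub>Q\<^esub> letter v b \<otimes>\<^bsub>Q\<^esub> inv\<^bsub>Q\<^esub> (s \<otimes>\<^bsub>Q\<^esub> letter c k)"
      proof (cases "v = c")
        case True
        then show ?thesis using assoc[OF letter_closed[OF vV v(2)]] self v by simp
      next
        case False
        then show ?thesis using assoc[OF letter_closed[OF vV v(2)]] other[OF vV False v(2)] s(2) v by simp
      qed
    next
      fix v b assume v: "v \<in> V - insert c C" "b \<in> carrier (G v)"
      then show "s \<otimes>\<^bsub>Q\<^esub> letter c k \<otimes>\<^bsub>Q\<^esub> letter v b \<otimes>\<^bsub>Q\<^esub> inv\<^bsub>Q\<^esub> (s \<otimes>\<^bsub>Q\<^esub> letter c k) = letter v b"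
        using assoc[OF letter_closed[of v b]] other[of v b] s(3)[of v b] by simp
    qed (use s c k in simp)
  qed
  moreover have "finite {v. central_vertex V E v}"
    using \<open>finite V\<close> by (rule finite_subset[rotated]) (auto simp: central_vertex_def)
  ultimately obtain s where s: "s \<in> carrier Q"
    "\<And>v b. central_vertex V E v \<Longrightarrow> b \<in> carrier (G v) \<Longrightarrow> \<psi> (letter v b) = s \<otimes>\<^bsub>Q\<^esub> letter v b \<otimes>\<^bsub>Q\<^esub> inv\<^bsub>Q\<^esub> s"
    "\<And>v b. v \<in> V \<Longrightarrow> \<not> central_vertex V E v \<Longrightarrow> b \<in> carrier (G v)
      \<Longrightarrow> s \<otimes>\<^bsub>Q\<^esub> letter v b \<otimes>\<^bsub>Q\<^esub> inv\<^bsub>Q\<^esub> s = letter v b"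
    by (metis (no_types, lifting) DiffI mem_Collect_eq subset_refl)
  \<comment> \<open>At a non-central vertex both sides equal the letter itself, by
    \<open>noncentral\<close> and by the second property of \<open>s\<close>.\<close>
  have \<psi>_letter: "\<psi> (letter v b) = s \<otimes>\<^bsub>Q\<^esub> letter v b \<otimes>\<^bsub>Q\<^esub> inv\<^bsub>Q\<^esub> s" if "v \<in> V" "b \<in> carrier (G v)" for v b
    using s(2,3)[of v b] \<alpha>[OF that] noncentral[of v b] that by metis
  have \<psi>_inner: "\<psi> (pi w) = s \<otimes>\<^bsub>Q\<^esub> pi w \<otimes>\<^bsub>Q\<^esub> inv\<^bsub>Q\<^esub> s" if "w \<in> W" for w
    using that
  proof (induction w)
    case Nil
    have "\<phi> \<one>\<^bsub>Q\<^esub> = \<one>\<^bsub>Q\<^esub>" using hom Q.is_group Q.is_group by (rule hom_one)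
    then show ?case using h s(1) by (simp add: \<psi>_def pi_Nil)
  next
    case (Cons x w)
    then show ?case using s(1) by (simp add: pi_Cons \<psi>_mult \<psi>_letter Q_simps)
  qed
  show "inner_automorphism Q \<phi>"
    unfolding inner_automorphism_def
  proof (intro bexI[of _ "h \<otimes>\<^bsub>Q\<^esub> s"] ballI)
    fix q assume q: "q \<in> carrier Q"
    then obtain w where w: "w \<in> W" "q = pi w" using pi_surj by blast
    have "\<phi> q = h \<otimes>\<^bsub>Q\<^esub> \<psi> q \<otimes>\<^bsub>Q\<^esub> inv\<^bsub>Q\<^esub> h" using q h by (simp add: \<psi>_def Q_simps)
    also have "\<psi> q = s \<otimes>\<^bsub>Q\<^esub> q \<otimes>\<^bsub>Q\<^esub> inv\<^bsub>Q\<^esub> s" using w \<psi>_inner by simp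
    finally show "\<phi> q = h \<otimes>\<^bsub>Q\<^esub> s \<otimes>\<^bsub>Q\<^esub> q \<otimes>\<^bsub>Q\<^esub> inv\<^bsub>Q\<^esub> (h \<otimes>\<^bsub>Q\<^esub> s)"
      using q h s(1) by (simp add: Q_simps)
  qed (use h s in simp)
qed

end

theorem corollary1p2:
  fixes V :: "'v set" and E :: "'v set set" and G :: "'v \<Rightarrow> ('a, 'b) monoid_scheme"
  assumes "finite V" and "simplicial_graph V E"
    and "\<And>v. v \<in> V \<Longrightarrow> group (G v)"
    and "\<And>v. v \<in> V \<Longrightarrow> \<not> trivial_group (G v)"
  shows "grossman_property_A (graph_product V E G) \<longleftrightarrow>
    (\<forall>v. central_vertex V E v \<longrightarrow> grossman_property_A (G v))"
proof -
  interpret graph_of_groups V E G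
    using assms(2,3) by (rule graph_of_groups.intro)
  have "\<exists>g\<in>carrier (G v). g \<noteq> \<one>\<^bsub>G v\<^esub>" if "v \<in> V" for v
    using assms(3,4)[OF that] that vertex_one by (fastforce simp: trivial_group_def)
  then show ?thesis
    using property_A_central_vertex property_A_graph_product[OF assms(1)] by blast
qed

end
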